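(* A topologically typical bivariate copula is mutually completely dependent and has full support; that is, the set of all $C\in\mathcal{C}$ such that $C$ is mutually completely dependent and $\mathrm{supp}(\mu_C)=[0,1]^2$ is co-meager in $(\mathcal{C},d_\infty)$.
   Context: $\mathbb{I}=[0,1]$, $\lambda$ is Lebesgue measure on $\mathbb{I}$. $\mathcal{C}$ is the family of all bivariate copulas (restrictions to $\mathbb{I}^2$ of bivariate distribution functions with uniform marginals on $\mathbb{I}$), $d_\infty$ is the uniform metric on $\mathcal{C}$, and $\mu_C$ is the doubly stochastic measure with $\mu_C([0,x]\times[0,y])=C(x,y)$. A (Borel) map $h:\mathbb{I}\to\mathbb{I}$ is $\lambda$-preserving if $\lambda(h^{-1}(F))=\lambda(F)$ for every $F\in\mathcal{B}(\mathbb{I})$. $C$ is completely dependent if there is a $\lambda$-preserving $h$ such that $\mu_C$ is concentrated on the graph of $h$ (equivalently, its Markov kernel, i.e. the conditional distribution of $Y$ given $X=x$ for $(X,Y)\sim C$, is $K_C(x,F)=\mathbf{1}_F(h(x))$ for $\lambda$-almost all $x$); it is mutually completely dependent if in addition $h$ can be chosen bijective. A subset of a topological space is nowhere dense if its closure has empty interior, meager (of first category) if it is covered by countably many nowhere dense sets, and co-meager if its complement is meager. "Typical" means belonging to a co-meager set. *)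

theory Defs
  imports "HOL-Probability.Probability"
begin

section \<open>The unit interval and the unit square\<close>

abbreviation unit_interval :: "real set" where
  "unit_interval \<equiv> {0..1}"

abbreviation unit_square :: "(real \<times> real) set" where
  "unit_square \<equiv> unit_interval \<times> unit_interval"

text \<open>Lebesgue measure on the Borel sets of the unit interval.\<close>

definition leb_unit :: "real measure" where
  "leb_unit = restrict_space lborel unit_interval"

text \<open>Only the values of \<open>h\<close> on the unit interval matter.\<close>

definition leb_preserving :: "(real \<Rightarrow> real) \<Rightarrow> bool" where
  "leb_preserving h \<longleftrightarrow>
     h \<in> measurable leb_unit leb_unit \<and>
     (\<forall>F \<in> sets leb_unit. emeasure leb_unit (h -` F \<inter> unit_interval) = emeasure leb_unit F)"


section \<open>Copulas\<close>

definition bivariate_cdf :: "(real \<times> real) measure \<Rightarrow> real \<times> real \<Rightarrow> real" where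
  "bivariate_cdf M = (\<lambda>(x, y). measure M ({..x} \<times> {..y}))"

text \<open>Copulas are extensional functions (\<open>undefined\<close> outside the unit square), so that
  equality of copulas is equality on the unit square.\<close>

definition copulas :: "(real \<times> real \<Rightarrow> real) set" where
  "copulas =
     {restrict (bivariate_cdf M) unit_square | M.
        prob_space M \<and> sets M = sets borel \<and>
        distr M borel fst = uniform_measure lborel unit_interval \<and>
        distr M borel snd = uniform_measure lborel unit_interval}"

text \<open>The metric of \<open>funspace\<close> is the supremum metric; see \<open>mdist_copula_metric\<close> below.\<close>

definition copula_metric :: "(real \<times> real \<Rightarrow> real) metric" where
  "copula_metric = submetric (funspace unit_square euclidean_metric) copulas"

definition doubly_stochastic :: "(real \<times> real) measure \<Rightarrow> bool" where
  "doubly_stochastic M \<longleftrightarrow>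
     sets M = sets (restrict_space borel unit_square) \<and>
     distr M leb_unit fst = leb_unit \<and> distr M leb_unit snd = leb_unit"

text \<open>The description is proper for every copula; see \<open>copula_measure_ex1\<close> below.\<close>

definition copula_measure :: "(real \<times> real \<Rightarrow> real) \<Rightarrow> (real \<times> real) measure" where
  "copula_measure C =
     (THE M. doubly_stochastic M \<and>
        (\<forall>x \<in> unit_interval. \<forall>y \<in> unit_interval. measure M ({0..x} \<times> {0..y}) = C (x, y)))"

definition completely_dependent_via :: "(real \<times> real \<Rightarrow> real) \<Rightarrow> (real \<Rightarrow> real) \<Rightarrow> bool" where
  "completely_dependent_via C h \<longleftrightarrow>
     leb_preserving h \<and> (AE (x, y) in copula_measure C. y = h x)"

definition mutually_completely_dependent :: "(real \<times> real \<Rightarrow> real) \<Rightarrow> bool" where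
  "mutually_completely_dependent C \<longleftrightarrow>
     (\<exists>h. completely_dependent_via C h \<and> bij_betw h unit_interval unit_interval)"

text \<open>The support is taken in the subspace topology of \<open>space M\<close>: the complement of the
  union of all relatively open null sets.\<close>

definition measure_support :: "'a::topological_space measure \<Rightarrow> 'a set" where
  "measure_support M = space M - \<Union>{U. open U \<and> emeasure M (U \<inter> space M) = 0}"


section \<open>Baire category\<close>

definition nowhere_dense_in :: "'a topology \<Rightarrow> 'a set \<Rightarrow> bool" where
  "nowhere_dense_in X S \<longleftrightarrow> S \<subseteq> topspace X \<and> X interior_of (X closure_of S) = {}"

definition meager_in :: "'a topology \<Rightarrow> 'a set \<Rightarrow> bool" where
  "meager_in X S \<longleftrightarrow>
     (\<exists>\<N>. countable \<N> \<and> (\<forall>N \<in> \<N>. nowhere_dense_in X N) \<and> S \<subseteq> \<Union>\<N>)"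

definition comeager_in :: "'a topology \<Rightarrow> 'a set \<Rightarrow> bool" where
  "comeager_in X S \<longleftrightarrow> S \<subseteq> topspace X \<and> meager_in X (topspace X - S)"


section \<open>Well-definedness\<close>

lemma copulas_subset_fspace:
  "copulas \<subseteq> mspace (funspace unit_square euclidean_metric)"
proof
  fix C assume "C \<in> copulas"
  then obtain M where M: "prob_space M" and C: "C = restrict (bivariate_cdf M) unit_square"
    unfolding copulas_def by blast
  interpret prob_space M by (fact M)
  have "C ` unit_square \<subseteq> {0..1}"
    by (auto simp: C bivariate_cdf_def prob_le_1)
  then have bd: "bounded (C ` unit_square)"
    using bounded_subset bounded_closed_interval by blast
  have "C \<in> extensional unit_square"
    by (simp add: C)
  with bd show "C \<in> mspace (funspace unit_square euclidean_metric)"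
    by (simp add: Met_TC.fspace_def)
qed

lemma mspace_copula_metric [simp]: "mspace copula_metric = copulas"
  using copulas_subset_fspace by (auto simp: copula_metric_def)

lemma mdist_copula_metric:
  assumes "A \<in> copulas" "B \<in> copulas"
  shows "mdist copula_metric A B = (SUP p \<in> unit_square. \<bar>A p - B p\<bar>)"
proof -
  have "A \<in> mspace (funspace unit_square euclidean_metric)"
    "B \<in> mspace (funspace unit_square euclidean_metric)"
    using assms copulas_subset_fspace by blast+
  then show ?thesis
    by (simp add: copula_metric_def Met_TC.fdist_def dist_real_def)
qed

lemma space_leb_unit [simp]: "space leb_unit = unit_interval"
  by (simp add: leb_unit_def space_restrict_space)

lemma sets_leb_unit: "sets leb_unit = sets (restrict_space borel unit_interval)"
  unfolding leb_unit_def by (rule sets_restrict_space_cong) simp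

lemma sets_leb_unit_iff: "F \<in> sets leb_unit \<longleftrightarrow> F \<subseteq> unit_interval \<and> F \<in> sets borel"
  by (simp add: sets_leb_unit sets_restrict_space_iff)

lemma emeasure_leb_unit: "F \<in> sets leb_unit \<Longrightarrow> emeasure leb_unit F = emeasure lborel F"
  unfolding leb_unit_def
  by (rule emeasure_restrict_space)
     (auto simp: sets_leb_unit_iff [unfolded leb_unit_def])

lemma unit_square_borel [measurable]: "unit_square \<in> sets borel"
  by (intro borel_closed closed_Times) auto

lemma sets_unit_square_iff:
  "X \<in> sets (restrict_space borel unit_square) \<longleftrightarrow> X \<subseteq> unit_square \<and> X \<in> sets borel"
  using unit_square_borel by (subst sets_restrict_space_iff) auto

lemma doubly_stochastic_space: "doubly_stochastic M \<Longrightarrow> space M = unit_square"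
  unfolding doubly_stochastic_def
  by (metis sets_eq_imp_space_eq space_restrict_space2 unit_square_borel space_borel
      space_restrict_space Int_UNIV_right)

lemma measurable_proj_unit:
  assumes "sets M = sets (restrict_space borel unit_square)"
  shows "fst \<in> measurable M leb_unit" "snd \<in> measurable M leb_unit"
proof -
  have "fst \<in> measurable (restrict_space borel unit_square) (restrict_space borel unit_interval)"
    "snd \<in> measurable (restrict_space borel unit_square) (restrict_space borel unit_interval)"
    by (auto intro!: measurable_restrict_space3 borel_measurable_continuous_onI
        continuous_intros)
  then show "fst \<in> measurable M leb_unit" "snd \<in> measurable M leb_unit"
    by (simp_all only: measurable_cong_sets[OF assms sets_leb_unit])
qed

lemma prob_space_leb_unit: "prob_space leb_unit"
  by standard (simp add: emeasure_leb_unit sets_leb_unit_iff)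

lemma doubly_stochastic_prob_space:
  assumes "doubly_stochastic M" shows "prob_space M"
proof (rule prob_space_distrD[of fst M leb_unit])
  show "fst \<in> measurable M leb_unit"
    using assms measurable_proj_unit by (auto simp: doubly_stochastic_def)
  show "prob_space (distr M leb_unit fst)"
    using assms prob_space_leb_unit by (simp add: doubly_stochastic_def)
qed

lemma copula_measure_unique:
  assumes M: "doubly_stochastic M" and N: "doubly_stochastic N"
    and eq: "\<And>x y. x \<in> unit_interval \<Longrightarrow> y \<in> unit_interval \<Longrightarrow>
      measure M ({0..x} \<times> {0..y}) = measure N ({0..x} \<times> {0..y})"
  shows "M = N"
proof -
  let ?D = "\<lambda>L. distr L (borel :: (real \<times> real) measure) (\<lambda>p. p)"
  have id: "(\<lambda>p. p) \<in> measurable L borel" if L: "doubly_stochastic L" for L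
  proof -
    have sL: "sets L = sets (restrict_space borel unit_square)"
      using L by (simp add: doubly_stochastic_def)
    have "(\<lambda>p. p) \<in> measurable (restrict_space borel unit_square) borel"
      by (rule measurable_restrict_space1) simp
    then show ?thesis
      by (subst measurable_cong_sets[OF sL refl])
  qed
  have quad: "emeasure (?D L) {..p} =
      (if 0 \<le> fst p \<and> 0 \<le> snd p
       then ennreal (measure L ({0..min 1 (fst p)} \<times> {0..min 1 (snd p)})) else 0)"
    if L: "doubly_stochastic L" for L and p :: "real \<times> real"
  proof -
    interpret L: prob_space L by (rule doubly_stochastic_prob_space) fact
    have "emeasure (?D L) {..p} = emeasure L ({..p} \<inter> unit_square)"
      using id[OF L] by (subst emeasure_distr) (auto simp: doubly_stochastic_space[OF L])
    also have "{..p} \<inter> unit_square =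
      (if 0 \<le> fst p \<and> 0 \<le> snd p then {0..min 1 (fst p)} \<times> {0..min 1 (snd p)} else {})"
      by (auto simp: less_eq_prod_def)
    finally show ?thesis by (simp add: L.emeasure_eq_measure)
  qed
  have "?D M = ?D N"
  proof (rule measure_eqI_generator_eq[where \<Omega> = UNIV and E = "range atMost"
        and A = "\<lambda>n. {..(real n, real n)}"])
    show "Int_stable (range (atMost :: real \<times> real \<Rightarrow> _))"
    proof (rule Int_stableI)
      fix a b :: "(real \<times> real) set" assume "a \<in> range atMost" "b \<in> range atMost"
      then obtain p q where "a = {..p}" "b = {..q}" by auto
      then have "a \<inter> b = {..(min (fst p) (fst q), min (snd p) (snd q))}"
        by (auto simp: less_eq_prod_def)
      then show "a \<inter> b \<in> range atMost" by blast
    qed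
    show "emeasure (?D M) X = emeasure (?D N) X" if "X \<in> range atMost" for X
      using that eq by (auto simp: quad[OF M] quad[OF N])
    have "sets (borel :: (real \<times> real) measure) = sigma_sets UNIV (range atMost)"
      by (subst borel_eq_atMost) auto
    then show "sets (?D M) = sigma_sets UNIV (range atMost)"
      "sets (?D N) = sigma_sets UNIV (range atMost)" by auto
    show "(\<Union>n. {..(real n, real n)}) = UNIV"
    proof (intro equalityI subsetI UNIV_I)
      fix p :: "real \<times> real"
      obtain n where "max (fst p) (snd p) \<le> real n"
        using real_arch_simple by blast
      then show "p \<in> (\<Union>n. {..(real n, real n)})"
        by (auto simp: less_eq_prod_def intro!: exI[of _ n])
    qed
    show "emeasure (?D M) {..(real n, real n)} \<noteq> \<infinity>" for n
      by (simp add: quad[OF M])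
  qed auto
  moreover have "emeasure (?D L) X = emeasure L X"
    if L: "doubly_stochastic L" and X: "X \<subseteq> unit_square" "X \<in> sets borel" for L X
    using id[OF L] X by (subst emeasure_distr)
      (auto simp: doubly_stochastic_space[OF L] intro!: arg_cong[where f = "emeasure L"])
  ultimately have "emeasure M X = emeasure N X" if "X \<subseteq> unit_square" "X \<in> sets borel" for X
    using that M N by metis
  then show ?thesis
    using M N by (intro measure_eqI) (simp_all add: doubly_stochastic_def sets_unit_square_iff)
qed

lemma copula_measure_ex1:
  assumes "C \<in> copulas"
  shows "\<exists>!M. doubly_stochastic M \<and>
    (\<forall>x \<in> unit_interval. \<forall>y \<in> unit_interval. measure M ({0..x} \<times> {0..y}) = C (x, y))"
proof -
  obtain M where M: "prob_space M" and sM: "sets M = sets borel"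
    and f: "distr M borel fst = uniform_measure lborel unit_interval"
    and s: "distr M borel snd = uniform_measure lborel unit_interval"
    and C: "C = restrict (bivariate_cdf M) unit_square"
    using assms unfolding copulas_def by blast
  interpret M: prob_space M by (fact M)
  have spM: "space M = UNIV"
    using sets_eq_imp_space_eq[OF sM] by simp
  have mf [measurable]: "fst \<in> borel_measurable M" "snd \<in> borel_measurable M"
    by (subst measurable_cong_sets[OF sM refl],
        intro borel_measurable_continuous_onI continuous_intros)+
  have marg: "emeasure M (g -` F) = emeasure lborel (unit_interval \<inter> F)"
    if "g \<in> borel_measurable M" "distr M borel g = uniform_measure lborel unit_interval"
      "F \<in> sets borel" for g F
  proof -
    have "emeasure M (g -` F) = emeasure (distr M borel g) F"
      using that(1,3) by (simp add: emeasure_distr spM)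
    also have "\<dots> = emeasure lborel (unit_interval \<inter> F) * inverse 1"
      using that by (simp add: divide_ennreal_def)
    finally show ?thesis
      by simp
  qed
  have ae: "AE p in M. g p \<in> unit_interval"
    if g: "g \<in> borel_measurable M" "distr M borel g = uniform_measure lborel unit_interval" for g
  proof -
    have "g -` (- unit_interval) \<in> null_sets M"
      using measurable_sets[OF g(1), of "- unit_interval"]
      by (auto simp: null_sets_def marg[OF g] spM)
    then show ?thesis
      by (rule AE_I') auto
  qed
  have AE_sq: "AE p in M. p \<in> unit_square"
    using ae[OF mf(1) f] ae[OF mf(2) s] by eventually_elim (auto simp: mem_Times_iff)
  define N where "N = restrict_space M unit_square"
  have sN: "sets N = sets (restrict_space borel unit_square)"
    unfolding N_def by (rule sets_restrict_space_cong) fact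
  have spN: "space N = unit_square"
    by (simp add: N_def space_restrict_space spM)
  have eN: "emeasure N X = emeasure M X" if "X \<subseteq> unit_square" for X
    unfolding N_def using that unit_square_borel
    by (subst emeasure_restrict_space) (auto simp: sM spM)
  have marg_N: "distr N leb_unit g = leb_unit"
    if g: "g \<in> borel_measurable M" "distr M borel g = uniform_measure lborel unit_interval"
      and gN: "g \<in> measurable N leb_unit" for g
  proof (rule measure_eqI)
    fix F assume "F \<in> sets (distr N leb_unit g)"
    then have F: "F \<in> sets leb_unit" by simp
    then have Fb: "F \<subseteq> unit_interval" "F \<in> sets borel" by (auto simp: sets_leb_unit_iff)
    have gF: "g -` F \<in> sets M"
      using measurable_sets[OF g(1) Fb(2)] by (simp add: spM)
    have "emeasure (distr N leb_unit g) F = emeasure M (g -` F \<inter> unit_square)"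
      using gN F by (simp add: emeasure_distr spN eN)
    also have "\<dots> = emeasure M (g -` F)"
      using AE_sq gF unit_square_borel
      by (intro emeasure_eq_AE) (auto simp: sM)
    also have "\<dots> = emeasure leb_unit F"
      using F Fb by (simp add: marg[OF g] emeasure_leb_unit Int_absorb1)
    finally show "emeasure (distr N leb_unit g) F = emeasure leb_unit F" .
  qed simp
  have "doubly_stochastic N"
    unfolding doubly_stochastic_def
    using sN marg_N[OF mf(1) f] marg_N[OF mf(2) s] measurable_proj_unit[OF sN] by blast
  moreover have "measure N ({0..x} \<times> {0..y}) = C (x, y)"
    if xy: "x \<in> unit_interval" "y \<in> unit_interval" for x y
  proof -
    have "measure N ({0..x} \<times> {0..y}) = measure M ({0..x} \<times> {0..y})"
      using xy by (subst (1 2) measure_def) (subst eN, auto)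
    also have "\<dots> = measure M ({..x} \<times> {..y})"
      using AE_sq
      by (intro measure_eq_AE) (auto simp: sM intro!: borel_closed closed_Times)
    finally show ?thesis
      using xy by (simp add: C bivariate_cdf_def)
  qed
  ultimately show ?thesis
    by (intro ex1I[of _ N]) (auto intro!: copula_measure_unique)
qed

end

theory Submission
  imports Defs
begin

text \<open>Each condition on a copula is written as a countable intersection of open dense sets.

  \<open>Y\<close> is a function of \<open>X\<close> as soon as every event \<open>{Y \<le> q}\<close>, \<open>q\<close> rational, can be approximated
  in measure by events \<open>{X \<in> B}\<close>, by the Borel--Cantelli lemma.  If \<open>B\<close> ranges over finite unions of
  intervals, being able to approximate up to a given error is an open condition on \<open>C\<close>.  It is dense,
  since replacing \<open>Y\<close> in each of \<open>N\<close> vertical strips by the quantile transform of its conditional law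
  moves \<open>C\<close> by at most \<open>1 / N\<close> and makes \<open>{Y \<le> q}\<close> a union of \<open>N\<close> intervals in \<open>X\<close>.
  Exchanging the coordinates gives \<open>X = g Y\<close> as well.  Then \<open>h\<close> and \<open>g\<close> are inverse to
  each other almost everywhere; both are made injective on all of \<open>[0, 1]\<close> by rerouting the bad points into
  the Cantor set, and a Borel version of the Schroeder--Bernstein argument yields a bijection.

  For the support, giving positive mass to a fixed rectangle is an open condition, and it is dense
  because one can mix with the product copula.\<close>

section \<open>A Borel copy of the unit interval in the Cantor set\<close>

definition binary_digit :: "nat \<Rightarrow> real \<Rightarrow> real" where
  "binary_digit n x = real_of_int (\<lfloor>2 ^ Suc n * x\<rfloor> mod 2)"

text \<open>Each binary digit is doubled and read in base 3. On \<open>[0, 1)\<close> this is a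
  right inverse of the Cantor function, with values in the ternary Cantor set.\<close>

definition cantor_map :: "real \<Rightarrow> real" where
  "cantor_map x = (\<Sum>n. 2 / 3 * ((1 / 3) ^ n * binary_digit n x))"

lemma binary_digit_cases: "binary_digit n x = 0 \<or> binary_digit n x = 1"
  unfolding binary_digit_def by (metis of_int_0 of_int_1 mod_2_eq_odd of_bool_def)

lemma binary_digit_bounds: "0 \<le> binary_digit n x" "binary_digit n x \<le> 1"
  using binary_digit_cases[of n x] by auto

lemma binary_digit_Suc: "binary_digit (Suc n) x = binary_digit n (2 * x)"
  by (simp add: binary_digit_def mult.assoc mult.left_commute)

lemma binary_digit_add_1: "binary_digit n (x + 1) = binary_digit n x"
proof -
  have "2 ^ Suc n * (x + 1) = 2 ^ Suc n * x + real_of_int (2 ^ Suc n)"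
    by (simp add: algebra_simps)
  then have "\<lfloor>2 ^ Suc n * (x + 1)\<rfloor> = \<lfloor>2 ^ Suc n * x\<rfloor> + 2 ^ Suc n"
    by (metis floor_add_int)
  then show ?thesis
    by (simp add: binary_digit_def)
qed

lemma summable_cantor: "summable (\<lambda>n. 2 / 3 * ((1 / 3) ^ n * binary_digit n x))"
proof (rule summable_comparison_test')
  show "summable (\<lambda>n. 2 / 3 * (1 / 3 :: real) ^ n)"
    by (intro summable_mult summable_geometric) auto
  show "norm (2 / 3 * ((1 / 3) ^ n * binary_digit n x)) \<le> 2 / 3 * (1 / 3) ^ n" for n
    using binary_digit_bounds[of n x] by (simp add: abs_mult mult_left_le)
qed

lemma cantor_map_nonneg: "0 \<le> cantor_map x"
  unfolding cantor_map_def
  by (intro suminf_nonneg summable_cantor) (simp add: binary_digit_bounds)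

lemma cantor_map_le_1: "cantor_map x \<le> 1"
proof -
  have "cantor_map x \<le> (\<Sum>n. 2 / 3 * (1 / 3 :: real) ^ n)"
    unfolding cantor_map_def
    by (intro suminf_le summable_cantor summable_mult summable_geometric)
      (auto simp: binary_digit_bounds mult_left_le)
  also have "\<dots> = 1"
    by (subst suminf_mult) (auto simp: suminf_geometric)
  finally show ?thesis .
qed

text \<open>Doubling shifts the binary digits by one place, so the tail of the series for
  \<open>x\<close> is a third of the series for \<open>2 * x\<close>. This is the self-similarity of
  the Cantor set.\<close>

lemma cantor_map_rec: "cantor_map x = 2 / 3 * binary_digit 0 x + cantor_map (2 * x) / 3"
proof -
  have "cantor_map x = 2 / 3 * binary_digit 0 x
      + (\<Sum>n. 2 / 3 * ((1 / 3) ^ Suc n * binary_digit (Suc n) x))"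
    unfolding cantor_map_def by (subst suminf_split_head[OF summable_cantor]) simp_all
  also have "(\<Sum>n. 2 / 3 * ((1 / 3) ^ Suc n * binary_digit (Suc n) x))
      = (\<Sum>n. 1 / 3 * (2 / 3 * ((1 / 3) ^ n * binary_digit n (2 * x))))"
    by (simp add: binary_digit_Suc mult_ac)
  also have "\<dots> = 1 / 3 * cantor_map (2 * x)"
    unfolding cantor_map_def by (rule suminf_mult[OF summable_cantor])
  finally show ?thesis by simp
qed

lemma cantor_map_left:
  assumes "0 \<le> x" "x < 1 / 2" shows "cantor_map x = cantor_map (2 * x) / 3"
proof -
  have "\<lfloor>2 * x\<rfloor> = 0" using assms by linarith
  then show ?thesis by (subst cantor_map_rec) (simp add: binary_digit_def)
qed

lemma cantor_map_right:
  assumes "1 / 2 \<le> x" "x < 1" shows "cantor_map x = 2 / 3 + cantor_map (2 * x - 1) / 3"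
proof -
  have "\<lfloor>2 * x\<rfloor> = 1" using assms by linarith
  moreover have "cantor_map (2 * x) = cantor_map (2 * x - 1)"
    using binary_digit_add_1[of _ "2 * x - 1"] by (simp add: cantor_map_def)
  ultimately show ?thesis by (subst cantor_map_rec) (simp add: binary_digit_def)
qed

text \<open>While both points lie in the same half, passing to \<open>2 * x\<close> or
  \<open>2 * x - 1\<close> doubles the gap, which drives the induction on \<open>n\<close>. Once
  they lie in different halves, the values are at most 1/3 and at least 2/3.\<close>

lemma cantor_map_less:
  assumes "0 \<le> x" "x < y" "y < 1" shows "cantor_map x < cantor_map y"
proof -
  obtain n where "(1 / 2) ^ n < y - x"
    using real_arch_pow_inv[of "y - x" "1 / 2"] assms by auto
  then show ?thesis
    using assms
  proof (induction n arbitrary: x y)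
    case 0
    then show ?case by simp
  next
    case (Suc n)
    consider "y < 1 / 2" | "x < 1 / 2" "1 / 2 \<le> y" | "1 / 2 \<le> x" by linarith
    then show ?case
    proof cases
      case 1
      have "cantor_map (2 * x) < cantor_map (2 * y)"
        using Suc.prems 1 by (intro Suc.IH) auto
      then show ?thesis using Suc.prems 1 by (simp add: cantor_map_left)
    next
      case 2
      then show ?thesis
        using Suc.prems cantor_map_le_1[of "2 * x"] cantor_map_nonneg[of "2 * y - 1"]
        by (simp add: cantor_map_left cantor_map_right)
    next
      case 3
      have "cantor_map (2 * x - 1) < cantor_map (2 * y - 1)"
        using Suc.prems 3 by (intro Suc.IH) auto
      then show ?thesis using Suc.prems 3 by (simp add: cantor_map_right)
    qed
  qed
qed

lemma cantor_map_borel [measurable]: "cantor_map \<in> borel_measurable borel"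
  unfolding cantor_map_def[abs_def] binary_digit_def by measurable

text \<open>The left inverse is the generalized inverse, a supremum over a sublevel set of
  \<open>e\<close>. It is nondecreasing in \<open>y\<close>, hence Borel even if \<open>e\<close>
  has jumps.\<close>

lemma strict_mono_on_left_inverse_borel:
  fixes e :: "real \<Rightarrow> real"
  assumes "a \<le> b" "I \<subseteq> {a..b}" and e: "strict_mono_on I e"
  obtains e' where "e' \<in> borel_measurable borel" "\<And>y. e' y \<in> {a..b}"
    "\<And>x. x \<in> I \<Longrightarrow> e' (e x) = x"
proof
  \<comment> \<open>Adding \<open>a\<close> keeps the set nonempty when \<open>y\<close> is below
    all values of \<open>e\<close>.\<close>
  define S where "S y = insert a {x \<in> I. e x \<le> y}" for y
  have S: "S y \<noteq> {}" "S y \<subseteq> {a..b}" for y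
    using assms by (auto simp: S_def)
  then have bdd: "bdd_above (S y)" for y
    by (meson bdd_above_Icc bdd_above_mono)
  show "(\<lambda>y. Sup (S y)) \<in> borel_measurable borel"
    by (intro borel_measurable_mono monoI cSup_subset_mono bdd) (auto simp: S_def)
  show "Sup (S y) \<in> {a..b}" for y
    using S[of y] bdd[of y] by (auto simp: S_def intro!: cSup_upper cSup_least)
  show "Sup (S (e x)) = x" if x: "x \<in> I" for x
  proof (rule cSup_eq_maximum)
    show "x \<in> S (e x)"
      using x by (simp add: S_def)
    show "z \<le> x" if "z \<in> S (e x)" for z
      using that x e \<open>I \<subseteq> {a..b}\<close>
      by (auto simp: S_def) (meson not_le strict_mono_onD)
  qed
qed

text \<open>\<open>W\<close> is the image of \<open>[0, 1)\<close> under \<open>cantor_map\<close>: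
  Borel thanks to the left inverse, null thanks to self-similarity. It offers room in a null set to
  which exceptional points can be moved injectively.\<close>

lemma null_borel_copy_of_unit_interval:
  obtains e e' W where "e \<in> borel_measurable borel" "e' \<in> borel_measurable borel"
    "W \<in> null_sets lborel" "\<And>x. x \<in> unit_interval \<Longrightarrow> e x \<in> W \<inter> unit_interval"
    "\<And>x. x \<in> unit_interval \<Longrightarrow> e' (e x) = x" "\<And>y. e' y \<in> unit_interval"
proof -
  have mono: "strict_mono_on {0..<1} cantor_map"
    by (intro strict_mono_onI) (auto intro!: cantor_map_less)
  have sub: "{0..<1} \<subseteq> {0..1 :: real}" by auto
  obtain c' where [measurable]: "c' \<in> borel_measurable borel"
    and c': "\<And>y. c' y \<in> {0..1}" "\<And>x. x \<in> {0..<1} \<Longrightarrow> c' (cantor_map x) = x"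
    by (rule strict_mono_on_left_inverse_borel[OF zero_le_one sub mono]) blast
  define V where "V = cantor_map ` {0..<1}"
  \<comment> \<open>A point lies in the image exactly when decoding and encoding returns it, which
    is a Borel condition.\<close>
  have "V = {y \<in> space borel. c' y \<in> {0..<1} \<and> cantor_map (c' y) = y}"
  proof (intro equalityI subsetI)
    fix y assume "y \<in> {y \<in> space borel. c' y \<in> {0..<1} \<and> cantor_map (c' y) = y}"
    then show "y \<in> V"
      unfolding V_def by (intro image_eqI[of _ _ "c' y"]) simp_all
  qed (use c'(2) in \<open>auto simp: V_def\<close>)
  also have "\<dots> \<in> sets borel" by measurable
  finally have V [measurable]: "V \<in> sets borel" .
  have V01: "V \<subseteq> {0..1}"
    by (auto simp: V_def cantor_map_nonneg cantor_map_le_1)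
  \<comment> \<open>\<open>T 0\<close> and \<open>T (2 / 3)\<close> are copies of \<open>V\<close>
    scaled by 1/3. They cover \<open>V\<close>, one for each value of the first binary
    digit.\<close>
  define T where "T t = (\<lambda>v. (1 / 3) *\<^sub>R v + t) ` V" for t :: real
  have T_eq: "T t = {y \<in> space borel. 3 * (y - t) \<in> V}" for t
  proof (intro equalityI subsetI)
    fix y assume "y \<in> {y \<in> space borel. 3 * (y - t) \<in> V}"
    then show "y \<in> T t"
      unfolding T_def by (intro image_eqI[of _ _ "3 * (y - t)"]) (simp_all add: field_simps)
  qed (auto simp: T_def)
  have T [measurable]: "T t \<in> sets borel" for t
    unfolding T_eq by measurable
  have eT: "emeasure lborel (T t) = ennreal (1 / 3) * emeasure lborel V" for t
    using emeasure_lebesgue_affine[of "1 / 3" t V, folded T_def] by simp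
  have "V \<subseteq> T 0 \<union> T (2 / 3)"
  proof
    fix v assume "v \<in> V"
    then obtain x where x: "v = cantor_map x" "0 \<le> x" "x < 1" by (auto simp: V_def)
    show "v \<in> T 0 \<union> T (2 / 3)"
    proof (cases "x < 1 / 2")
      case True
      then have "3 * (v - 0) = cantor_map (2 * x)" using x by (simp add: cantor_map_left)
      then have "v \<in> T 0" using x True by (simp add: T_eq V_def)
      then show ?thesis ..
    next
      case False
      then have "3 * (v - 2 / 3) = cantor_map (2 * x - 1)" using x by (simp add: cantor_map_right)
      then have "v \<in> T (2 / 3)" using x False unfolding T_eq V_def by simp
      then show ?thesis ..
    qed
  qed
  then have "emeasure lborel V \<le> emeasure lborel (T 0 \<union> T (2 / 3))"
    by (intro emeasure_mono) auto
  also have "\<dots> \<le> emeasure lborel (T 0) + emeasure lborel (T (2 / 3))"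
    by (intro emeasure_subadditive) auto
  also have "\<dots> = ennreal (2 / 3) * emeasure lborel V"
    by (simp add: eT distrib_right[symmetric] ennreal_plus[symmetric] del: ennreal_plus)
  \<comment> \<open>A finite measure that is at most two thirds of itself vanishes.\<close>
  finally have "emeasure lborel V \<le> ennreal (2 / 3) * emeasure lborel V" .
  moreover have "emeasure lborel V \<noteq> \<infinity>"
    using emeasure_mono[OF V01, of lborel] by (auto simp: top_unique)
  ultimately have "emeasure lborel V = 0"
    by (cases "emeasure lborel V") (auto simp: ennreal_mult[symmetric] ennreal_le_iff)
  then have "V \<in> null_sets lborel" by (simp add: null_sets_def)
  \<comment> \<open>Halving moves all of \<open>[0, 1]\<close>, including the endpoint 1, into
    \<open>[0, 1)\<close>, where \<open>cantor_map\<close> is injective. The decoder doubles again,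
    and \<open>min 1\<close> caps what it does to points outside the image.\<close>
  moreover have "cantor_map (x / 2) \<in> V \<inter> unit_interval" if "x \<in> unit_interval" for x
    using that by (auto simp: V_def cantor_map_nonneg cantor_map_le_1)
  moreover have "min 1 (2 * c' (cantor_map (x / 2))) = x" if "x \<in> unit_interval" for x
    using that by (simp add: c')
  moreover have "min 1 (2 * c' y) \<in> unit_interval" for y
    using c'(1)[of y] by auto
  ultimately show thesis
    by (intro that[of "\<lambda>x. cantor_map (x / 2)" "\<lambda>y. min 1 (2 * c' y)" V]) auto
qed


section \<open>Bijective modification of almost everywhere invertible maps\<close>

text \<open>\<open>S\<close> collects the orbits under \<open>k\<close> after \<open>f\<close> of
  the points outside the range of \<open>k\<close>; the bijection is \<open>f\<close> on
  \<open>S\<close> and the inverse of \<open>k\<close> elsewhere. The given left inverses turn the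
  images involved into Borel sets. The last conclusion lets almost everywhere properties shared by
  \<open>f\<close> and \<open>k'\<close> pass to the bijection.\<close>

lemma borel_Schroeder_Bernstein:
  fixes f f' k k' :: "'a::{second_countable_topology, t2_space} \<Rightarrow> 'a"
  assumes [measurable]: "f \<in> borel_measurable borel" "f' \<in> borel_measurable borel"
    "k \<in> borel_measurable borel" "k' \<in> borel_measurable borel" "I \<in> sets borel"
    and into: "\<And>x. x \<in> I \<Longrightarrow> f x \<in> I" "\<And>x. x \<in> I \<Longrightarrow> f' x \<in> I"
      "\<And>x. x \<in> I \<Longrightarrow> k x \<in> I" "\<And>x. x \<in> I \<Longrightarrow> k' x \<in> I"
    and inv: "\<And>x. x \<in> I \<Longrightarrow> f' (f x) = x" "\<And>x. x \<in> I \<Longrightarrow> k' (k x) = x"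
  obtains \<phi> where "\<phi> \<in> borel_measurable borel" "bij_betw \<phi> I I" "\<And>x. \<phi> x = f x \<or> \<phi> x = k' x"
proof -
  \<comment> \<open>For \<open>A\<close> inside \<open>I\<close>, this is the image of
    \<open>A\<close> under \<open>k\<close> after \<open>f\<close>, written as a preimage condition
    so that it is visibly Borel.\<close>
  define step where
    "step A = {x \<in> space borel. x \<in> I \<and> f' (k' x) \<in> A \<and> k (f (f' (k' x))) = x}" for A
  \<comment> \<open>These are the points of \<open>I\<close> outside \<open>k\<close> applied to
    \<open>I\<close>.\<close>
  define S0 where "S0 = {x \<in> space borel. x \<in> I \<and> k (k' x) \<noteq> x}"
  define S where "S = (\<Union>n. (step ^^ n) S0)"
  have step: "step A \<in> sets borel" if [measurable]: "A \<in> sets borel" for A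
    unfolding step_def by measurable
  have "S0 \<in> sets borel"
    unfolding S0_def by measurable
  then have "(step ^^ n) S0 \<in> sets borel" for n
    by (induction n) (simp_all add: step)
  then have S [measurable]: "S \<in> sets borel"
    unfolding S_def by blast
  have S_I: "S \<subseteq> I"
  proof -
    have "step A \<subseteq> I" for A by (auto simp: step_def)
    moreover have "S0 \<subseteq> I" by (auto simp: S0_def)
    ultimately have "(step ^^ n) S0 \<subseteq> I" for n
      by (cases n) simp_all
    then show ?thesis unfolding S_def by blast
  qed
  have S_step: "k (f x) \<in> S" if x: "x \<in> S" for x
  proof -
    obtain n where "x \<in> (step ^^ n) S0" using x unfolding S_def by blast
    moreover have "k (f x) \<in> step A" if "x \<in> A" for A
    proof -
      have "x \<in> I" "f x \<in> I" "k (f x) \<in> I"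
        using \<open>x \<in> S\<close> S_I into by blast+
      with that show ?thesis by (simp add: step_def inv)
    qed
    ultimately have "k (f x) \<in> (step ^^ Suc n) S0" by simp
    then show ?thesis unfolding S_def by blast
  qed
  have S_cases: "x \<in> S0 \<or> (\<exists>z \<in> S. k (f z) = x)" if x: "x \<in> S" for x
  proof -
    obtain n where n: "x \<in> (step ^^ n) S0" using x unfolding S_def by blast
    show ?thesis
    proof (cases n)
      case (Suc m)
      with n have "x \<in> step ((step ^^ m) S0)" by simp
      then have "f' (k' x) \<in> (step ^^ m) S0" "k (f (f' (k' x))) = x"
        unfolding step_def by blast+
      then have "f' (k' x) \<in> S" "k (f (f' (k' x))) = x"
        unfolding S_def by blast+
      then show ?thesis by blast
    qed (use n in simp)
  qed
  have S0_S: "S0 \<subseteq> S"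
  proof -
    have "(step ^^ 0) S0 \<subseteq> S" unfolding S_def by blast
    then show ?thesis by simp
  qed
  have kk': "k (k' x) = x" if "x \<in> I" "x \<notin> S" for x
    using that S0_S by (auto simp: S0_def)
  define \<phi> where "\<phi> x = (if x \<in> S then f x else k' x)" for x
  \<comment> \<open>Applying \<open>k\<close> separates the two values: one lands in
    \<open>S\<close>, the other is \<open>y\<close> itself, outside \<open>S\<close>.\<close>
  have mixed: "f x \<noteq> k' y" if "x \<in> S" "y \<in> I" "y \<notin> S" for x y
    using S_step[OF that(1)] kk'[OF that(2,3)] that(3) by metis
  have "inj_on \<phi> I"
  proof (rule inj_onI)
    fix x y assume xy: "x \<in> I" "y \<in> I" and eq: "\<phi> x = \<phi> y"
    consider "x \<in> S" "y \<in> S" | "x \<in> S" "y \<notin> S" | "x \<notin> S" "y \<in> S" | "x \<notin> S" "y \<notin> S"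
      by blast
    then show "x = y"
    proof cases
      case 1
      then show ?thesis using eq xy inv(1) by (simp add: \<phi>_def) metis
    next
      case 2
      then show ?thesis using eq xy mixed[of x y] by (simp add: \<phi>_def)
    next
      case 3
      then show ?thesis using eq xy mixed[of y x] by (simp add: \<phi>_def)
    next
      case 4
      then show ?thesis using eq xy kk' by (simp add: \<phi>_def) metis
    qed
  qed
  moreover have "\<phi> ` I = I"
  proof (intro equalityI subsetI)
    fix y assume y: "y \<in> I"
    show "y \<in> \<phi> ` I"
    proof (cases "k y \<in> S")
      case True
      \<comment> \<open>Since \<open>k y\<close> is in the range of \<open>k\<close>, it must have a
        predecessor \<open>z\<close> in \<open>S\<close>, and injectivity of \<open>k\<close> then
        gives \<open>f z = y\<close>.\<close>
      have "k y \<notin> S0" using y by (simp add: S0_def inv)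
      then obtain z where z: "z \<in> S" "k (f z) = k y" using S_cases[OF True] by blast
      then have "f z = y"
        using y S_I inv(2)[of y] inv(2)[of "f z"] into(1)[of z] by auto
      then show ?thesis using z S_I by (force simp: \<phi>_def)
    next
      case False
      then have "\<phi> (k y) = y" using y by (simp add: \<phi>_def inv)
      then show ?thesis using y into(3) by (metis image_eqI)
    qed
  qed (auto simp: \<phi>_def into)
  ultimately have "bij_betw \<phi> I I"
    by (simp add: bij_betw_def)
  moreover have "\<phi> \<in> borel_measurable borel"
    unfolding \<phi>_def by measurable
  ultimately show thesis
    by (intro that) (auto simp: \<phi>_def)
qed

lemma measurable_leb_unit:
  assumes [measurable]: "h \<in> borel_measurable borel"
    and "\<And>x. x \<in> unit_interval \<Longrightarrow> h x \<in> unit_interval"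
  shows "h \<in> measurable leb_unit leb_unit"
  unfolding measurable_cong_sets[OF sets_leb_unit sets_leb_unit]
  by (intro measurable_restrict_space3) (use assms in auto)

text \<open>Where \<open>g\<close> fails to invert \<open>h\<close>, points are sent into a null set that contains a Borel copy
  of the whole unit interval.\<close>

lemma borel_injective_modification:
  assumes h: "leb_preserving h" and g: "leb_preserving g"
    and [measurable]: "h \<in> borel_measurable borel" "g \<in> borel_measurable borel"
    and into: "\<And>x. h x \<in> unit_interval" "\<And>x. g x \<in> unit_interval"
    and gh: "AE x in leb_unit. g (h x) = x"
  obtains f f' where "f \<in> borel_measurable borel" "f' \<in> borel_measurable borel"
    "\<And>x. x \<in> unit_interval \<Longrightarrow> f x \<in> unit_interval" "\<And>x. f' x \<in> unit_interval"
    "\<And>x. x \<in> unit_interval \<Longrightarrow> f' (f x) = x"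
    "AE x in leb_unit. f x = h x" "AE x in leb_unit. f' x = g x"
proof -
  obtain e e' W where [measurable]: "e \<in> borel_measurable borel" "e' \<in> borel_measurable borel"
    and W: "W \<in> null_sets lborel" and e: "\<And>x. x \<in> unit_interval \<Longrightarrow> e x \<in> W \<inter> unit_interval"
    and e': "\<And>x. x \<in> unit_interval \<Longrightarrow> e' (e x) = x" "\<And>y. e' y \<in> unit_interval"
    by (rule null_borel_copy_of_unit_interval) blast
  have [measurable]: "W \<in> sets borel" using W by auto
  have W_unit: "W \<inter> unit_interval \<in> sets leb_unit"
    by (auto simp: sets_leb_unit_iff)
  have W0: "emeasure leb_unit (W \<inter> unit_interval) = 0"
    using emeasure_mono[of "W \<inter> unit_interval" W lborel] null_setsD1[OF W]
    by (simp add: emeasure_leb_unit[OF W_unit])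
  \<comment> \<open>The guard \<open>h x \<notin> W\<close> keeps the two branches apart: the first
    has values outside \<open>W\<close>, the second inside. So \<open>f'\<close> can choose the
    right inverse by testing membership in \<open>W\<close>.\<close>
  define f where "f x = (if g (h x) = x \<and> h x \<notin> W then h x else e x)" for x
  define f' where "f' y = (if y \<in> W then e' y else g y)" for y
  have notW: "AE y in leb_unit. y \<notin> W"
    using W0 W_unit by (intro AE_I[where N = "W \<inter> unit_interval"]) auto
  have "h -` (W \<inter> unit_interval) \<inter> unit_interval \<in> sets leb_unit"
    by (auto simp: sets_leb_unit_iff)
  moreover have "emeasure leb_unit (h -` (W \<inter> unit_interval) \<inter> unit_interval) = 0"
    using h W_unit W0 unfolding leb_preserving_def by metis
  \<comment> \<open>As \<open>h\<close> preserves Lebesgue measure, it sends almost no point into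
    \<open>W\<close>, so the guard alters \<open>h\<close> only on a null set.\<close>
  ultimately have hW: "AE x in leb_unit. h x \<notin> W"
    using into by (intro AE_I[where N = "h -` (W \<inter> unit_interval) \<inter> unit_interval"]) auto
  show thesis
  proof
    show "f \<in> borel_measurable borel" "f' \<in> borel_measurable borel"
      unfolding f_def f'_def by measurable
    show "AE x in leb_unit. f x = h x"
      using gh hW by eventually_elim (simp add: f_def)
    show "AE x in leb_unit. f' x = g x"
      using notW by eventually_elim (simp add: f'_def)
  qed (use e e' into in \<open>auto simp: f_def f'_def\<close>)
qed

text \<open>Modify \<open>h\<close> to an injection \<open>f\<close>, and \<open>g\<close> to an
  injection \<open>k\<close> with left inverse \<open>k'\<close>. Both \<open>f\<close> and
  \<open>k'\<close> agree with \<open>h\<close> almost everywhere, and the Schroeder-Bernstein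
  bijection takes one of these two values at each point.\<close>

lemma leb_preserving_bijective_modification:
  assumes h: "leb_preserving h" and g: "leb_preserving g"
    and [measurable]: "h \<in> borel_measurable borel" "g \<in> borel_measurable borel"
    and into: "\<And>x. h x \<in> unit_interval" "\<And>x. g x \<in> unit_interval"
    and gh: "AE x in leb_unit. g (h x) = x" and hg: "AE x in leb_unit. h (g x) = x"
  obtains \<phi> where "\<phi> \<in> borel_measurable borel" "bij_betw \<phi> unit_interval unit_interval"
    "AE x in leb_unit. \<phi> x = h x"
proof -
  obtain f f' where f [measurable]: "f \<in> borel_measurable borel" "f' \<in> borel_measurable borel"
    and f': "\<And>x. x \<in> unit_interval \<Longrightarrow> f x \<in> unit_interval" "\<And>x. f' x \<in> unit_interval"
      "\<And>x. x \<in> unit_interval \<Longrightarrow> f' (f x) = x" "AE x in leb_unit. f x = h x"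
    by (rule borel_injective_modification[OF h g _ _ into gh]) auto
  obtain k k' where k [measurable]: "k \<in> borel_measurable borel" "k' \<in> borel_measurable borel"
    and k': "\<And>x. x \<in> unit_interval \<Longrightarrow> k x \<in> unit_interval" "\<And>x. k' x \<in> unit_interval"
      "\<And>x. x \<in> unit_interval \<Longrightarrow> k' (k x) = x" "AE x in leb_unit. k' x = h x"
    by (rule borel_injective_modification[OF g h _ _ into(2,1) hg]) auto
  have I: "unit_interval \<in> sets borel" by simp
  show thesis
  proof (rule borel_Schroeder_Bernstein[OF f k I f'(1,2) k'(1,2) f'(3) k'(3)])
    fix \<phi> assume \<phi>: "\<phi> \<in> borel_measurable borel" "bij_betw \<phi> unit_interval unit_interval"
      "\<And>x. \<phi> x = f x \<or> \<phi> x = k' x"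
    have "AE x in leb_unit. \<phi> x = h x"
      using f'(4) k'(4) by eventually_elim (metis \<phi>(3))
    with \<phi>(1,2) show thesis by (rule that)
  qed
qed


section \<open>Random variables that are functions of each other\<close>

text \<open>Choose \<open>B n\<close> with error below \<open>(1 / 2) ^ n\<close>. By Borel-Cantelli
  almost every outcome is misclassified only finitely often, so the limes superior of the
  \<open>B n\<close> represents the event exactly.\<close>

lemma (in prob_space) event_determined_by_rv:
  fixes X :: "'a \<Rightarrow> real"
  assumes [measurable]: "random_variable borel X" "E \<in> events"
    and approx: "\<And>e. 0 < e \<Longrightarrow> \<exists>B \<in> sets borel. prob {\<omega> \<in> space M. (\<omega> \<in> E) \<noteq> (X \<omega> \<in> B)} < e"
  shows "\<exists>B \<in> sets borel. AE \<omega> in M. \<omega> \<in> E \<longleftrightarrow> X \<omega> \<in> B"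
proof -
  have "\<exists>B. \<forall>n::nat. B n \<in> sets borel \<and>
      prob {\<omega> \<in> space M. (\<omega> \<in> E) \<noteq> (X \<omega> \<in> B n)} < (1 / 2) ^ n"
    using approx[of "(1 / 2) ^ _"] by (intro choice) auto
  then obtain B where B [measurable]: "\<And>n. B n \<in> sets borel"
    and small: "\<And>n. prob {\<omega> \<in> space M. (\<omega> \<in> E) \<noteq> (X \<omega> \<in> B n)} < (1 / 2) ^ n"
    by blast
  have "AE \<omega> in M. eventually (\<lambda>n. \<omega> \<in> space M - {\<omega> \<in> space M. (\<omega> \<in> E) \<noteq> (X \<omega> \<in> B n)}) sequentially"
  proof (rule borel_cantelli_AE1)
    show "summable (\<lambda>n. prob {\<omega> \<in> space M. (\<omega> \<in> E) \<noteq> (X \<omega> \<in> B n)})"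
      by (rule summable_comparison_test'[OF summable_geometric[of "1 / 2 :: real"], where N = 0])
        (use small in \<open>auto intro: less_imp_le\<close>)
  qed (auto simp: emeasure_eq_measure)
  then have "AE \<omega> in M. \<omega> \<in> E \<longleftrightarrow> X \<omega> \<in> (\<Inter>m. \<Union>n\<in>{m..}. B n)"
  proof eventually_elim
    case (elim \<omega>)
    then obtain N where N: "\<And>n. n \<ge> N \<Longrightarrow> \<omega> \<in> E \<longleftrightarrow> X \<omega> \<in> B n"
      by (auto simp: eventually_sequentially)
    have "X \<omega> \<in> (\<Inter>m. \<Union>n\<in>{m..}. B n) \<longleftrightarrow> (\<forall>m. \<exists>n\<ge>m. X \<omega> \<in> B n)"
      by auto
    also have "\<dots> \<longleftrightarrow> \<omega> \<in> E"
      using N by (meson max.cobounded1 max.cobounded2)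
    finally show ?case by simp
  qed
  then show ?thesis
    by (intro bexI[of _ "\<Inter>m. \<Union>n\<in>{m..}. B n"]) auto
qed

text \<open>A real number is the infimum of the rationals above it, so \<open>Y\<close> can be
  rebuilt from the countably many events \<open>{Y \<le> q}\<close>, each of which is almost surely
  an event in \<open>X\<close>.\<close>

lemma (in prob_space) rv_function_of_rv:
  fixes X Y :: "'a \<Rightarrow> real"
  assumes X [measurable]: "random_variable borel X" and Y [measurable]: "random_variable borel Y"
    and approx: "\<And>q e. q \<in> \<rat> \<Longrightarrow> 0 < e \<Longrightarrow>
      \<exists>B \<in> sets borel. prob {\<omega> \<in> space M. (Y \<omega> \<le> q) \<noteq> (X \<omega> \<in> B)} < e"
  shows "\<exists>h \<in> borel_measurable borel. AE \<omega> in M. Y \<omega> = h (X \<omega>)"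
proof -
  have "\<exists>B \<in> sets borel. AE \<omega> in M. Y \<omega> \<le> q \<longleftrightarrow> X \<omega> \<in> B" if q: "q \<in> \<rat>" for q
  proof -
    have "\<exists>B \<in> sets borel. AE \<omega> in M. \<omega> \<in> {\<omega> \<in> space M. Y \<omega> \<le> q} \<longleftrightarrow> X \<omega> \<in> B"
    proof (rule event_determined_by_rv)
      fix e :: real assume "0 < e"
      then show "\<exists>B \<in> sets borel.
          prob {\<omega> \<in> space M. (\<omega> \<in> {\<omega> \<in> space M. Y \<omega> \<le> q}) \<noteq> (X \<omega> \<in> B)} < e"
        using approx[OF q] by (simp cong: conj_cong)
    qed simp_all
    then obtain B where "B \<in> sets borel" "AE \<omega> in M. \<omega> \<in> {\<omega> \<in> space M. Y \<omega> \<le> q} \<longleftrightarrow> X \<omega> \<in> B"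
      by blast
    from this(2) have "AE \<omega> in M. Y \<omega> \<le> q \<longleftrightarrow> X \<omega> \<in> B"
      using AE_space by eventually_elim simp
    with \<open>B \<in> sets borel\<close> show ?thesis by blast
  qed
  then obtain B where B [measurable]: "\<And>q. q \<in> \<rat> \<Longrightarrow> B q \<in> sets borel"
    and eq: "\<And>q. q \<in> \<rat> \<Longrightarrow> AE \<omega> in M. Y \<omega> \<le> q \<longleftrightarrow> X \<omega> \<in> B q"
    by metis
  \<comment> \<open>The infimum is taken in the extended reals, where rationals \<open>q\<close>
    with \<open>x \<notin> B q\<close> contribute infinity. It is finite at almost every value taken
    by \<open>X\<close>.\<close>
  define h where "h x = real_of_ereal (INF q\<in>\<rat>. if x \<in> B q then ereal q else \<infinity>)" for x
  have "AE \<omega> in M. \<forall>q\<in>\<rat>. Y \<omega> \<le> q \<longleftrightarrow> X \<omega> \<in> B q"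
    using eq by (subst AE_ball_countable[OF countable_rat]) blast
  then have "AE \<omega> in M. Y \<omega> = h (X \<omega>)"
  proof eventually_elim
    case (elim \<omega>)
    have "(INF q\<in>\<rat>. if X \<omega> \<in> B q then ereal q else \<infinity>) = ereal (Y \<omega>)"
    proof (rule antisym)
      show "ereal (Y \<omega>) \<le> (INF q\<in>\<rat>. if X \<omega> \<in> B q then ereal q else \<infinity>)"
        using elim by (intro INF_greatest) auto
      show "(INF q\<in>\<rat>. if X \<omega> \<in> B q then ereal q else \<infinity>) \<le> ereal (Y \<omega>)"
      proof (rule dense_ge)
        fix z assume "ereal (Y \<omega>) < z"
        then obtain r where r: "Y \<omega> < r" "ereal r < z"
          using ereal_dense2[of "ereal (Y \<omega>)" z] by auto
        obtain q where q: "q \<in> \<rat>" "Y \<omega> < q" "q < r"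
          using Rats_dense_in_real[OF r(1)] by blast
        have "X \<omega> \<in> B q"
          using elim q(1) less_imp_le[OF q(2)] by blast
        then have "(INF q\<in>\<rat>. if X \<omega> \<in> B q then ereal q else \<infinity>) \<le> ereal q"
          by (intro INF_lower2[OF q(1)]) simp
        also have "ereal q \<le> z"
          using q r by (meson ereal_less_eq(3) less_imp_le order_trans)
        finally show "(INF q\<in>\<rat>. if X \<omega> \<in> B q then ereal q else \<infinity>) \<le> z" .
      qed
    qed
    then show ?case by (simp add: h_def)
  qed
  moreover have "h \<in> borel_measurable borel"
    unfolding h_def
    by (intro borel_measurable_real_of_ereal borel_measurable_INF countable_rat measurable_If) auto
  ultimately show ?thesis by blast
qed


section \<open>Copulas and their measures\<close>

locale copula =
  fixes C assumes copula: "C \<in> copulas"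
begin

abbreviation "\<mu> \<equiv> copula_measure C"

lemma doubly_stochastic_copula_measure: "doubly_stochastic \<mu>"
  and measure_copula_measure:
    "x \<in> unit_interval \<Longrightarrow> y \<in> unit_interval \<Longrightarrow> measure \<mu> ({0..x} \<times> {0..y}) = C (x, y)"
proof -
  let ?P = "\<lambda>M. doubly_stochastic M \<and>
    (\<forall>x \<in> unit_interval. \<forall>y \<in> unit_interval. measure M ({0..x} \<times> {0..y}) = C (x, y))"
  have *: "?P \<mu>"
    unfolding copula_measure_def by (rule theI'[OF copula_measure_ex1[OF copula]])
  then show "doubly_stochastic \<mu>" ..
  show "x \<in> unit_interval \<Longrightarrow> y \<in> unit_interval \<Longrightarrow> measure \<mu> ({0..x} \<times> {0..y}) = C (x, y)"
    using * by blast
qed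

sublocale prob_space \<mu>
  by (rule doubly_stochastic_prob_space[OF doubly_stochastic_copula_measure])

lemma sets_\<mu>: "A \<in> sets \<mu> \<longleftrightarrow> A \<subseteq> unit_square \<and> A \<in> sets borel"
  using doubly_stochastic_copula_measure sets_unit_square_iff
  by (auto simp: doubly_stochastic_def)

lemma space_\<mu> [simp]: "space \<mu> = unit_square"
  by (rule doubly_stochastic_space[OF doubly_stochastic_copula_measure])

lemma Times_sets_\<mu>:
  assumes "A \<in> sets borel" "A \<subseteq> unit_interval" "B \<in> sets borel" "B \<subseteq> unit_interval"
  shows "A \<times> B \<in> sets \<mu>"
  using assms by (auto simp: sets_\<mu> borel_prod[symmetric])

lemma measurable_\<mu>_leb_unit:
  "fst \<in> measurable \<mu> leb_unit" "snd \<in> measurable \<mu> leb_unit"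
  using doubly_stochastic_copula_measure measurable_proj_unit
  by (auto simp: doubly_stochastic_def)

lemma distr_\<mu>: "distr \<mu> leb_unit fst = leb_unit" "distr \<mu> leb_unit snd = leb_unit"
  using doubly_stochastic_copula_measure by (auto simp: doubly_stochastic_def)

lemma borel_measurable_\<mu> [measurable]:
  "fst \<in> borel_measurable \<mu>" "snd \<in> borel_measurable \<mu>"
proof -
  have "(\<lambda>x. x) \<in> borel_measurable leb_unit"
    by (simp add: leb_unit_def measurable_restrict_space1)
  then show "fst \<in> borel_measurable \<mu>" "snd \<in> borel_measurable \<mu>"
    using measurable_compose measurable_\<mu>_leb_unit by blast+
qed

lemma prob_fst:
  assumes "F \<in> sets borel" "F \<subseteq> unit_interval"
  shows "prob (F \<times> unit_interval) = measure lborel F"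
proof -
  have F: "F \<in> sets leb_unit" using assms by (simp add: sets_leb_unit_iff)
  have "emeasure leb_unit F = emeasure \<mu> (fst -` F \<inter> space \<mu>)"
    using emeasure_distr[OF measurable_\<mu>_leb_unit(1) F] by (simp add: distr_\<mu>)
  also have "fst -` F \<inter> space \<mu> = F \<times> unit_interval" using assms by auto
  finally show ?thesis using F by (simp add: measure_def emeasure_leb_unit)
qed

lemma prob_snd:
  assumes "F \<in> sets borel" "F \<subseteq> unit_interval"
  shows "prob (unit_interval \<times> F) = measure lborel F"
proof -
  have F: "F \<in> sets leb_unit" using assms by (simp add: sets_leb_unit_iff)
  have "emeasure leb_unit F = emeasure \<mu> (snd -` F \<inter> space \<mu>)"
    using emeasure_distr[OF measurable_\<mu>_leb_unit(2) F] by (simp add: distr_\<mu>)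
  also have "snd -` F \<inter> space \<mu> = unit_interval \<times> F" using assms by auto
  finally show ?thesis using F by (simp add: measure_def emeasure_leb_unit)
qed

text \<open>Strips are half-open so that those over consecutive intervals are disjoint and a
  difference of anchored rectangles describes them exactly.\<close>

lemma prob_strip:
  assumes "0 \<le> a" "a \<le> b" "b \<le> 1" "y \<in> unit_interval"
  shows "prob ({a<..b} \<times> {0..y}) = C (b, y) - C (a, y)"
proof -
  have "{a<..b} \<times> {0..y} = {0..b} \<times> {0..y} - {0..a} \<times> {0..y}"
    using assms by auto
  also have "prob \<dots> = prob ({0..b} \<times> {0..y}) - prob ({0..a} \<times> {0..y})"
    by (intro finite_measure_Diff Times_sets_\<mu>) (use assms in auto)
  finally show ?thesis
    using assms by (simp add: measure_copula_measure)
qed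

lemma prob_rectangle:
  assumes "0 \<le> a" "a \<le> b" "b \<le> 1" "0 \<le> c" "c \<le> d" "d \<le> 1"
  shows "prob ({a<..b} \<times> {c<..d}) = (C (b, d) - C (a, d)) - (C (b, c) - C (a, c))"
proof -
  have "{a<..b} \<times> {c<..d} = {a<..b} \<times> {0..d} - {a<..b} \<times> {0..c}"
    using assms by auto
  also have "prob \<dots> = prob ({a<..b} \<times> {0..d}) - prob ({a<..b} \<times> {0..c})"
    by (intro finite_measure_Diff Times_sets_\<mu>) (use assms in auto)
  finally show ?thesis
    using assms by (simp add: prob_strip)
qed

lemma copula_1_right: "x \<in> unit_interval \<Longrightarrow> C (x, 1) = x"
  using prob_fst[of "{0..x}"] measure_copula_measure[of x 1] by simp

lemma copula_1_left: "y \<in> unit_interval \<Longrightarrow> C (1, y) = y"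
  using prob_snd[of "{0..y}"] measure_copula_measure[of 1 y] by simp

lemma copula_0_left:
  assumes "y \<in> unit_interval" shows "C (0, y) = 0"
proof -
  have "prob ({0..0} \<times> {0..y}) \<le> prob ({0..0} \<times> unit_interval)"
    using assms by (intro finite_measure_mono Times_sets_\<mu>) auto
  then have "C (0, y) \<le> 0"
    using assms prob_fst[of "{0..0}"] measure_copula_measure[of 0 y] by simp
  moreover have "0 \<le> C (0, y)"
    using assms measure_copula_measure[of 0 y, symmetric] by simp
  ultimately show ?thesis by simp
qed

text \<open>A vertical strip has nonnegative mass, and by the uniform first marginal at most its
  width. Thus \<open>C\<close> is nondecreasing and 1-Lipschitz in its first argument.\<close>

lemma copula_strip_bounds:
  assumes "0 \<le> a" "a \<le> b" "b \<le> 1" "y \<in> unit_interval"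
  shows "C (a, y) \<le> C (b, y)" "C (b, y) - C (a, y) \<le> b - a"
proof -
  show "C (a, y) \<le> C (b, y)"
    using prob_strip[OF assms] measure_nonneg[of \<mu>] by (metis diff_ge_0_iff_ge)
  have "prob ({a<..b} \<times> {0..y}) \<le> prob ({a<..b} \<times> unit_interval)"
    by (intro finite_measure_mono Times_sets_\<mu>) (use assms in auto)
  then show "C (b, y) - C (a, y) \<le> b - a"
    using assms by (simp add: prob_strip prob_fst subset_eq)
qed

text \<open>Comparing a rectangle with the full horizontal strip shows that the mass of a vertical
  strip below a given height is nondecreasing and 1-Lipschitz in that height. The quantiles
  constructed below rely on this.\<close>

lemma copula_strip_mono:
  assumes "0 \<le> a" "a \<le> b" "b \<le> 1" "0 \<le> c" "c \<le> d" "d \<le> 1"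
  shows "C (b, c) - C (a, c) \<le> C (b, d) - C (a, d)"
    "(C (b, d) - C (a, d)) - (C (b, c) - C (a, c)) \<le> d - c"
proof -
  show "C (b, c) - C (a, c) \<le> C (b, d) - C (a, d)"
    using prob_rectangle[OF assms] measure_nonneg[of \<mu>] by (metis diff_ge_0_iff_ge)
  have "prob ({a<..b} \<times> {c<..d}) \<le> prob (unit_interval \<times> {c<..d})"
    by (intro finite_measure_mono Times_sets_\<mu>) (use assms in auto)
  then show "(C (b, d) - C (a, d)) - (C (b, c) - C (a, c)) \<le> d - c"
    using assms by (simp add: prob_rectangle prob_snd subset_eq)
qed

end

section \<open>The uniform law and copulas of a uniform variable with a function of it\<close>

lemma uniform_unit_interval:
  "prob_space (uniform_measure lborel unit_interval)"
  "sets (uniform_measure lborel unit_interval) = sets borel"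
  "A \<in> sets borel \<Longrightarrow> measure (uniform_measure lborel unit_interval) A = measure lborel (unit_interval \<inter> A)"
  by (auto intro!: prob_space_uniform_measure simp: measure_uniform_measure)

text \<open>Distribution functions determine laws. Outside \<open>[0, 1]\<close> the values are
  forced by monotonicity from the values 0 and 1 at the endpoints.\<close>

lemma eq_uniform_unit_interval:
  assumes "prob_space M" "sets M = sets borel"
    and "\<And>y. y \<in> unit_interval \<Longrightarrow> measure M {..y} = y"
  shows "M = uniform_measure lborel unit_interval"
proof (rule cdf_unique)
  let ?U = "uniform_measure lborel unit_interval"
  interpret M: prob_space M by fact
  interpret U: prob_space ?U by (rule uniform_unit_interval)
  show M: "real_distribution M" and U: "real_distribution ?U"
    using assms sets_eq_imp_space_eq[OF assms(2)]
    by (auto intro!: real_distribution.intro real_distribution_axioms.intro uniform_unit_interval)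
  have U_val: "measure ?U {..y} = y" if "y \<in> unit_interval" for y
  proof -
    have "unit_interval \<inter> {..y} = {0..y}" using that by auto
    then show ?thesis using that by (simp add: uniform_unit_interval)
  qed
  show "cdf M = cdf ?U"
  proof
    fix y :: real
    consider "y < 0" | "y \<in> unit_interval" | "1 < y" by fastforce
    then show "cdf M y = cdf ?U y"
    proof cases
      case 1
      then have "measure M {..y} \<le> measure M {..0}" "measure ?U {..y} \<le> measure ?U {..0}"
        by (intro M.finite_measure_mono U.finite_measure_mono; simp add: assms(2))+
      then show ?thesis
        using assms(3)[of 0] U_val[of 0] measure_nonneg[of M "{..y}"] measure_nonneg[of ?U "{..y}"]
        unfolding cdf_def by simp
    next
      case 2
      then show ?thesis using assms U_val by (simp add: cdf_def)
    next
      case 3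
      then have "measure M {..1} \<le> measure M {..y}" "measure ?U {..1} \<le> measure ?U {..y}"
        by (intro M.finite_measure_mono U.finite_measure_mono; simp add: assms(2))+
      then show ?thesis
        using assms(3)[of 1] U_val[of 1] M.prob_le_1[of "{..y}"] U.prob_le_1[of "{..y}"]
        unfolding cdf_def by simp
    qed
  qed
qed

text \<open>This is the distribution function of the pair \<open>(U, h U)\<close> with
  \<open>U\<close> uniform; the hypothesis on \<open>h\<close> says that \<open>h U\<close> is
  uniform too.\<close>

lemma function_copula:
  assumes [measurable]: "h \<in> borel_measurable borel"
    and h: "\<And>y. y \<in> unit_interval \<Longrightarrow> measure lborel {t \<in> {0..1}. h t \<le> y} = y"
  shows "(\<lambda>(x, y) \<in> unit_square. measure lborel {t \<in> {0..x}. h t \<le> y}) \<in> copulas"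
proof -
  let ?U = "uniform_measure lborel unit_interval"
  define M where "M = distr ?U borel (\<lambda>t. (t, h t))"
  interpret U: prob_space ?U by (rule uniform_unit_interval)
  have meas [measurable]: "(\<lambda>t. (t, h t)) \<in> measurable ?U borel"
    by (simp add: borel_prod[symmetric])
  have [measurable]: "fst \<in> borel_measurable (borel :: (real \<times> real) measure)"
    "snd \<in> borel_measurable (borel :: (real \<times> real) measure)"
    by (simp_all add: borel_prod[symmetric])
  have "prob_space M"
    unfolding M_def by (rule U.prob_space_distr[OF meas])
  moreover have "distr M borel fst = ?U"
    unfolding M_def by (subst distr_distr) (auto simp: comp_def intro!: distr_id2)
  moreover have "distr M borel snd = ?U"
  proof -
    have hU: "h \<in> borel_measurable ?U" by simp
    have "distr ?U borel h = ?U"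
    proof (rule eq_uniform_unit_interval)
      fix y :: real assume y: "y \<in> unit_interval"
      have "measure (distr ?U borel h) {..y} = measure ?U {t. h t \<le> y}"
        using measure_distr[OF hU, of "{..y}"] by (simp add: vimage_def)
      also have "\<dots> = measure lborel (unit_interval \<inter> {t. h t \<le> y})"
        by (rule uniform_unit_interval) measurable
      also have "unit_interval \<inter> {t. h t \<le> y} = {t \<in> {0..1}. h t \<le> y}" by auto
      finally show "measure (distr ?U borel h) {..y} = y" using h y by simp
    qed (auto intro!: U.prob_space_distr)
    then show ?thesis
      unfolding M_def by (subst distr_distr) (auto simp: comp_def)
  qed
  ultimately have "restrict (bivariate_cdf M) unit_square \<in> copulas"
    unfolding copulas_def by (auto intro!: exI[of _ M] simp: M_def)
  moreover have "restrict (bivariate_cdf M) unit_square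
      = (\<lambda>(x, y) \<in> unit_square. measure lborel {t \<in> {0..x}. h t \<le> y})"
  proof (rule restrict_ext, clarify)
    fix x y :: real assume xy: "x \<in> unit_interval" "y \<in> unit_interval"
    have "bivariate_cdf M (x, y) = measure ?U {t. t \<le> x \<and> h t \<le> y}"
    proof -
      have "{..x} \<times> {..y} \<in> sets borel" by (simp add: borel_prod[symmetric])
      moreover have "(\<lambda>t. (t, h t)) -` ({..x} \<times> {..y}) = {t. t \<le> x \<and> h t \<le> y}" by auto
      ultimately show ?thesis
        using measure_distr[OF meas, of "{..x} \<times> {..y}"] by (simp add: bivariate_cdf_def M_def)
    qed
    also have "\<dots> = measure lborel (unit_interval \<inter> {t. t \<le> x \<and> h t \<le> y})"
      by (rule uniform_unit_interval) measurable
    also have "unit_interval \<inter> {t. t \<le> x \<and> h t \<le> y} = {t \<in> {0..x}. h t \<le> y}"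
      using xy by auto
    finally show "bivariate_cdf M (x, y) = measure lborel {t \<in> {0..x}. h t \<le> y}" .
  qed
  ultimately show ?thesis by simp
qed


section \<open>Approximation by completely dependent copulas\<close>

context copula
begin

text \<open>\<open>Q\<close> is the quantile transform of the part of the mass over the strip
  \<open>{a<..b}\<close>. The mass \<open>G y\<close> of the strip below height \<open>y\<close> is
  continuous, so the infimum is attained, which yields the equivalence with non-strict inequalities
  on both sides.\<close>

lemma row_quantile:
  assumes ab: "0 \<le> a" "a < b" "b \<le> 1"
  defines "Q \<equiv> \<lambda>x. Inf {y \<in> unit_interval. x - a \<le> C (b, y) - C (a, y)}"
  assumes x: "a < x" "x \<le> b" and y: "y \<in> unit_interval"
  shows "Q x \<in> unit_interval" "Q x \<le> y \<longleftrightarrow> x \<le> a + (C (b, y) - C (a, y))"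
proof -
  define G where "G y = C (b, y) - C (a, y)" for y
  define S where "S = {y \<in> unit_interval. x - a \<le> G y}"
  have mono: "G c \<le> G d" "G d - G c \<le> d - c" if "0 \<le> c" "c \<le> d" "d \<le> 1" for c d
    using copula_strip_mono[of a b c d] that ab by (auto simp: G_def)
  have "1-lipschitz_on unit_interval G"
  proof (rule lipschitz_onI)
    fix c d assume cd: "c \<in> unit_interval" "d \<in> unit_interval"
    show "dist (G c) (G d) \<le> 1 * dist c d"
      using mono[of c d] mono[of d c] cd by (cases "c \<le> d") (auto simp: dist_real_def)
  qed simp
  then have cont: "continuous_on unit_interval G"
    by (rule lipschitz_on_continuous_on)
  have "1 \<in> S"
    using x ab by (simp add: S_def G_def copula_1_right)
  moreover have "closed S"
  proof -
    have "closed {y \<in> unit_interval. x - a \<in> {..G y}}" 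
      using continuous_closed_preimage[OF cont, of "{x - a..}"]
      by (simp add: vimage_def Int_def conj_commute)
    then show ?thesis by (simp add: S_def)
  qed
  moreover have bdd: "bdd_below S"
    by (auto simp: S_def)
  ultimately have "Inf S \<in> S"
    by (intro closed_contains_Inf) auto
  then have Q: "Q x \<in> S" by (simp add: Q_def S_def G_def)
  then show "Q x \<in> unit_interval" by (simp add: S_def)
  show "Q x \<le> y \<longleftrightarrow> x \<le> a + (C (b, y) - C (a, y))"
  proof
    assume "Q x \<le> y"
    then have "x - a \<le> G y" using Q mono[of "Q x" y] y by (auto simp: S_def)
    then show "x \<le> a + (C (b, y) - C (a, y))" by (simp add: G_def)
  next
    assume "x \<le> a + (C (b, y) - C (a, y))"
    then have "y \<in> S" using y by (simp add: S_def G_def)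
    then show "Q x \<le> y" using bdd by (simp add: Q_def S_def G_def cInf_lower)
  qed
qed

text \<open>In each of \<open>N\<close> strips the conditional law of \<open>Y\<close> is rearranged
  increasingly in \<open>X\<close>, giving a function \<open>h\<close> of \<open>X\<close>. Each
  strip keeps its mass below every height, so \<open>D\<close> agrees with \<open>C\<close> on the
  grid lines. The last conclusion says that all mass of strip \<open>i\<close> below
  \<open>y\<close> sits over an initial interval whose length is that mass.\<close>

lemma functional_approximation:
  assumes N: "0 < N"
  obtains D where "D \<in> copulas"
    "\<And>i y. i \<le> N \<Longrightarrow> y \<in> unit_interval \<Longrightarrow> D (real i / real N, y) = C (real i / real N, y)"
    "\<And>i y. i < N \<Longrightarrow> y \<in> unit_interval \<Longrightarrow>
      D (real i / real N + (C (real (Suc i) / real N, y) - C (real i / real N, y)), y)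
        - C (real i / real N, y) = C (real (Suc i) / real N, y) - C (real i / real N, y)"
proof -
  define p where "p i = real i / real N" for i
  define G where "G i y = C (p (Suc i), y) - C (p i, y)" for i y
  \<comment> \<open>The index of the strip \<open>{p i<..p (Suc i)}\<close> containing
    \<open>x\<close>; a ceiling minus one, because the strips are open on the left.\<close>
  define row where "row x = nat (\<lceil>real N * x\<rceil> - 1)" for x
  \<comment> \<open>Off \<open>{0<..1}\<close> the default 0 keeps \<open>h\<close> in the unit
    interval; within \<open>[0, 1]\<close> it concerns only the null set \<open>{0}\<close>.\<close>
  define h where "h x = (if x \<in> {0<..1}
    then Inf {y \<in> unit_interval. x - p (row x) \<le> C (p (Suc (row x)), y) - C (p (row x), y)} else 0)" for x
  have p: "0 \<le> p i" "p i < p (Suc i)" for i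
    using N by (auto simp: p_def divide_strict_right_mono)
  have p1: "p i \<le> 1" if "i \<le> N" for i
    using N that by (simp add: p_def)
  have pN: "p N = 1" "p 0 = 0" using N by (auto simp: p_def)
  have row_eq: "row x = i" if "p i < x" "x \<le> p (Suc i)" for x i
  proof -
    have "real i < real N * x" "real N * x \<le> real i + 1"
      using that N by (auto simp: p_def field_simps)
    then have "\<lceil>real N * x\<rceil> = int i + 1" by (intro ceiling_unique) auto
    then show ?thesis by (simp add: row_def)
  qed
  have row: "row x < N \<and> p (row x) < x \<and> x \<le> p (Suc (row x))" if "0 < x" "x \<le> 1" for x
  proof -
    have "0 < real N * x" "real N * x \<le> real N" using that N by auto
    then have "1 \<le> \<lceil>real N * x\<rceil>" "\<lceil>real N * x\<rceil> \<le> int N" by (auto simp: ceiling_le_iff)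
    then have r: "real (row x) = of_int \<lceil>real N * x\<rceil> - 1" and "row x < N" using N by (auto simp: row_def)
    have "real (row x) < real N * x" "real N * x \<le> real (row x) + 1"
      unfolding r by linarith+
    then show ?thesis using \<open>row x < N\<close> N by (auto simp: p_def field_simps)
  qed
  have G: "0 \<le> G i y" "G i y \<le> p (Suc i) - p i" if "i < N" "y \<in> unit_interval" for i y
    using copula_strip_bounds[of "p i" "p (Suc i)" y] p[of i] p1[of "Suc i"] that
    by (auto simp: G_def)
  have h_row: "h x \<in> unit_interval" "h x \<le> y \<longleftrightarrow> x \<le> p i + G i y"
    if "i < N" "p i < x" "x \<le> p (Suc i)" "y \<in> unit_interval" for i x y
  proof -
    have x: "0 < x" "x \<le> 1" using that p[of i] p1[of "Suc i"] by (auto intro: order_trans)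
    have i: "0 \<le> p i" "p i < p (Suc i)" "p (Suc i) \<le> 1" using that p p1 by auto
    have *: "h x = Inf {y \<in> unit_interval. x - p i \<le> C (p (Suc i), y) - C (p i, y)}"
      using x row_eq[OF that(2,3)] by (simp add: h_def)
    show "h x \<in> unit_interval" "h x \<le> y \<longleftrightarrow> x \<le> p i + G i y"
      using row_quantile[OF i that(2,3,4)] unfolding * G_def by blast+
  qed
  have h_unit: "h x \<in> unit_interval" for x
  proof (cases "x \<in> {0<..1}")
    case True
    then show ?thesis using row[of x] h_row(1)[of "row x" x 0] by auto
  qed (auto simp: h_def)
  have sub: "{x. h x \<le> y} = - {0<..1} \<union> (\<Union>i<N. {p i<..p i + G i y})" if y: "y \<in> unit_interval" for y
  proof (intro set_eqI)
    fix x
    show "x \<in> {x. h x \<le> y} \<longleftrightarrow> x \<in> - {0<..1} \<union> (\<Union>i<N. {p i<..p i + G i y})"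
    proof (cases "x \<in> {0<..1}")
      case False
      then show ?thesis using y by (auto simp: h_def)
    next
      case True
      then have r: "row x < N" "p (row x) < x" "x \<le> p (Suc (row x))" using row by auto
      \<comment> \<open>The bound on \<open>G\<close> keeps each interval inside its own strip, so
        only the strip of \<open>x\<close> can contribute.\<close>
      have uniq: "i = row x" if "i < N" "p i < x" "x \<le> p i + G i y" for i
        using row_eq[of i x] that G(2)[OF that(1) y] by simp
      have "x \<in> (\<Union>i<N. {p i<..p i + G i y}) \<longleftrightarrow> (\<exists>i<N. p i < x \<and> x \<le> p i + G i y)"
        by auto
      also have "\<dots> \<longleftrightarrow> x \<le> p (row x) + G (row x) y"
        using r(1,2) uniq by metis
      also have "\<dots> \<longleftrightarrow> h x \<le> y"
        using h_row(2)[OF r y] by simp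
      finally show ?thesis using True by simp
    qed
  qed
  \<comment> \<open>Measurability follows from the explicit sublevel sets, which are finite unions
    of intervals up to a fixed Borel set.\<close>
  have h [measurable]: "h \<in> borel_measurable borel"
  proof (subst borel_measurable_iff_le, intro allI)
    fix y :: real
    consider "y < 0" | "1 < y" | "y \<in> unit_interval" by fastforce
    then show "{x \<in> space borel. h x \<le> y} \<in> sets borel"
    proof cases
      case 1
      then have "{x \<in> space borel. h x \<le> y} = {}"
        using h_unit by (auto simp: not_le intro: less_le_trans)
      then show ?thesis by (simp only: sets.empty_sets)
    next
      case 2
      then have "h x \<le> y" for x using h_unit[of x] by simp
      then show ?thesis by simp
    next
      case 3
      have "{x \<in> space borel. h x \<le> y} = {x. h x \<le> y}" by simp
      also have "\<dots> \<in> sets borel" unfolding sub[OF 3] by measurable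
      finally show ?thesis .
    qed
  qed
  define F where "F x y = measure lborel {t \<in> {0..x}. h t \<le> y}" for x y
  have F_diff: "F b y - F a y = measure lborel {t \<in> {a<..b}. h t \<le> y}" if "0 \<le> a" "a \<le> b" for a b y
  proof -
    have [measurable]: "{t \<in> {0..a}. h t \<le> y} \<in> sets borel" "{t \<in> {0..b}. h t \<le> y} \<in> sets borel"
      by measurable
    have fin: "emeasure lborel {t \<in> {0..b}. h t \<le> y} \<noteq> \<infinity>"
    proof -
      have "emeasure lborel {t \<in> {0..b}. h t \<le> y} \<le> emeasure lborel {0..b}"
        by (intro emeasure_mono) auto
      also have "\<dots> < \<infinity>" using that by simp
      finally show ?thesis by simp
    qed
    have "{t \<in> {a<..b}. h t \<le> y} = {t \<in> {0..b}. h t \<le> y} - {t \<in> {0..a}. h t \<le> y}"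
      using that by auto
    also have "measure lborel \<dots> = F b y - F a y"
      unfolding F_def by (intro measure_Diff fin) (use that in auto)
    finally show ?thesis by simp
  qed
  \<comment> \<open>Inside strip \<open>i\<close> the sublevel set is an initial interval of length
    \<open>G i y\<close>, cut off at \<open>x\<close>.\<close>
  have F_row: "F x y - F (p i) y = min (x - p i) (G i y)"
    if "i < N" "p i \<le> x" "x \<le> p (Suc i)" and y: "y \<in> unit_interval" for i x y
  proof -
    have "{t \<in> {p i<..x}. h t \<le> y} = {p i<..min x (p i + G i y)}"
      using h_row(2)[OF that(1) _ _ y] that by auto
    then show ?thesis
      using that p[of i] G(1)[OF that(1) y] by (simp add: F_diff min_def)
  qed
  have F_grid: "F (p i) y = C (p i, y)" if "i \<le> N" "y \<in> unit_interval" for i y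
    using that(1)
  proof (induction i)
    case 0
    have "{t \<in> {0..0}. h t \<le> y} = {0}"
      using that by (auto simp: h_def)
    then show ?case using that by (simp add: pN F_def copula_0_left)
  next
    case (Suc i)
    have "F (p (Suc i)) y - F (p i) y = min (p (Suc i) - p i) (G i y)"
      using Suc that p[of i] by (intro F_row) auto
    also have "\<dots> = G i y" using G(2)[of i y] Suc that by (simp add: min_def)
    finally show ?case using Suc by (simp add: G_def)
  qed
  define D where "D = (\<lambda>(x, y) \<in> unit_square. F x y)"
  have D: "D (x, y) = F x y" if "x \<in> unit_interval" "y \<in> unit_interval" for x y
    using that by (simp add: D_def)
  show thesis
  proof
    show "D \<in> copulas"
      unfolding D_def F_def
    proof (rule function_copula[OF h])
      fix y :: real assume y: "y \<in> unit_interval"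
      show "measure lborel {t \<in> {0..1}. h t \<le> y} = y"
        \<comment> \<open>The last grid line is at 1, where the values of \<open>C\<close> are those
          of the uniform second marginal.\<close>
        using F_grid[of N y] y by (simp add: pN copula_1_left F_def)
    qed
    show grid: "D (real i / real N, y) = C (real i / real N, y)" if "i \<le> N" "y \<in> unit_interval" for i y
      using F_grid[OF that] D[of "p i" y] p(1)[of i] p1[OF that(1)] that(2) by (simp add: p_def)
    fix i y assume iy: "i < N" "y \<in> unit_interval"
    have "p i + G i y \<in> unit_interval"
      using G[OF iy] p[of i] p1[of "Suc i"] iy by auto
    moreover have "F (p i + G i y) y - F (p i) y = G i y"
      using F_row[of i "p i + G i y" y] G[OF iy] iy by simp
    ultimately have "D (p i + G i y, y) - C (p i, y) = G i y"
      using F_grid[of i y] iy D by simp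
    then show "D (real i / real N + (C (real (Suc i) / real N, y) - C (real i / real N, y)), y)
        - C (real i / real N, y) = C (real (Suc i) / real N, y) - C (real i / real N, y)"
      by (simp add: p_def G_def)
  qed
qed

end

text \<open>Move from \<open>x\<close> left to the nearest grid point. The copulas agree there, and
  both increments lie between 0 and \<open>1 / N\<close>.\<close>

lemma copulas_close_of_grid:
  assumes C: "C \<in> copulas" and D: "D \<in> copulas" and N: "0 < N"
    and grid: "\<And>i y. i \<le> N \<Longrightarrow> y \<in> unit_interval \<Longrightarrow> D (real i / real N, y) = C (real i / real N, y)"
    and xy: "x \<in> unit_interval" "y \<in> unit_interval"
  shows "\<bar>C (x, y) - D (x, y)\<bar> \<le> 1 / real N"
proof -
  interpret C: copula C by unfold_locales fact
  interpret D: copula D by unfold_locales fact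
  define i where "i = nat \<lfloor>real N * x\<rfloor>"
  define a where "a = real i / real N"
  have "0 \<le> real N * x" using xy N by simp
  then have i: "real i \<le> real N * x" "real N * x < real i + 1"
    unfolding i_def by linarith+
  have a: "0 \<le> a" "a \<le> x" "x - a \<le> 1 / real N" "i \<le> N"
  proof -
    show "0 \<le> a" by (simp add: a_def)
    show "a \<le> x" using i N by (simp add: a_def field_simps)
    have "x - a = (real N * x - real i) / real N" using N by (simp add: a_def field_simps)
    also have "\<dots> \<le> 1 / real N" using i N by (intro divide_right_mono) auto
    finally show "x - a \<le> 1 / real N" .
    have "real N * x \<le> real N" using xy N by simp
    then show "i \<le> N" using i by linarith
  qed
  have "D (a, y) = C (a, y)" using grid[OF a(4) xy(2)] by (simp add: a_def)
  then show ?thesis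
    using C.copula_strip_bounds[of a x y] D.copula_strip_bounds[of a x y] a xy
    by (auto simp: abs_le_iff)
qed


section \<open>Operations on copulas\<close>

lemma vimage_proj_borel:
  fixes A :: "real set"
  assumes "A \<in> sets borel"
  shows "fst -` A \<in> sets (borel :: (real \<times> real) measure)"
    "snd -` A \<in> sets (borel :: (real \<times> real) measure)"
proof -
  have "fst -` A = A \<times> (UNIV :: real set)" "snd -` A = (UNIV :: real set) \<times> A" by auto
  with assms show "fst -` A \<in> sets (borel :: (real \<times> real) measure)"
    "snd -` A \<in> sets (borel :: (real \<times> real) measure)"
    by (simp_all add: borel_prod[symmetric])
qed

lemma bivariate_cdf_in_copulas:
  assumes "prob_space M" "sets M = sets borel"
    and "\<And>A. A \<in> sets borel \<Longrightarrow> emeasure M (fst -` A) = emeasure (uniform_measure lborel unit_interval) A"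
    and "\<And>A. A \<in> sets borel \<Longrightarrow> emeasure M (snd -` A) = emeasure (uniform_measure lborel unit_interval) A"
  shows "restrict (bivariate_cdf M) unit_square \<in> copulas"
proof -
  have sp: "space M = UNIV"
    using sets_eq_imp_space_eq[OF assms(2)] by simp
  have meas: "fst \<in> borel_measurable M" "snd \<in> borel_measurable M"
    unfolding measurable_cong_sets[OF assms(2) refl]
    by (simp_all add: borel_prod[symmetric])
  have "distr M borel fst = uniform_measure lborel unit_interval"
    by (rule measure_eqI) (auto simp: emeasure_distr[OF meas(1)] sp assms(3))
  moreover have "distr M borel snd = uniform_measure lborel unit_interval"
    by (rule measure_eqI) (auto simp: emeasure_distr[OF meas(2)] sp assms(4))
  ultimately show ?thesis
    using assms(1,2) unfolding copulas_def by blast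
qed

lemma copula_obtain_measure:
  assumes "C \<in> copulas"
  obtains M where "prob_space M" "sets M = sets borel" "C = restrict (bivariate_cdf M) unit_square"
    "\<And>A. A \<in> sets borel \<Longrightarrow> emeasure M (fst -` A) = emeasure (uniform_measure lborel unit_interval) A"
    "\<And>A. A \<in> sets borel \<Longrightarrow> emeasure M (snd -` A) = emeasure (uniform_measure lborel unit_interval) A"
proof -
  obtain M where M: "prob_space M" "sets M = sets borel" "C = restrict (bivariate_cdf M) unit_square"
    and d: "distr M borel fst = uniform_measure lborel unit_interval"
      "distr M borel snd = uniform_measure lborel unit_interval"
    using assms unfolding copulas_def by blast
  have sp: "space M = UNIV"
    using sets_eq_imp_space_eq[OF M(2)] by simp
  have meas: "fst \<in> borel_measurable M" "snd \<in> borel_measurable M"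
    unfolding measurable_cong_sets[OF M(2) refl]
    by (simp_all add: borel_prod[symmetric])
  show thesis
  proof (rule that[OF M])
    fix A :: "real set" assume "A \<in> sets borel"
    then show "emeasure M (fst -` A) = emeasure (uniform_measure lborel unit_interval) A"
      "emeasure M (snd -` A) = emeasure (uniform_measure lborel unit_interval) A"
      using emeasure_distr[OF meas(1), of A] emeasure_distr[OF meas(2), of A]
      unfolding d by (simp_all only: sp Int_UNIV_right)
  qed
qed

lemma product_copula: "(\<lambda>(x, y) \<in> unit_square. x * y) \<in> copulas"
proof -
  let ?U = "uniform_measure lborel unit_interval"
  interpret U: prob_space ?U by (rule uniform_unit_interval)
  interpret UU: pair_prob_space ?U ?U ..
  have s: "sets (?U \<Otimes>\<^sub>M ?U) = sets borel"
    by (simp add: borel_prod[symmetric] cong: sets_pair_measure_cong)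
  have times: "emeasure (?U \<Otimes>\<^sub>M ?U) (A \<times> B) = emeasure ?U A * emeasure ?U B"
    if "A \<in> sets borel" "B \<in> sets borel" for A B
    using that by (intro U.emeasure_pair_measure_Times) auto
  have one: "emeasure ?U UNIV = 1"
    using U.emeasure_space_1 by simp
  have "restrict (bivariate_cdf (?U \<Otimes>\<^sub>M ?U)) unit_square \<in> copulas"
  proof (rule bivariate_cdf_in_copulas[OF _ s])
    show "prob_space (?U \<Otimes>\<^sub>M ?U)" by (rule UU.P.prob_space_axioms)
    fix A :: "real set" assume A: "A \<in> sets borel"
    have "fst -` A = A \<times> (UNIV :: real set)" "snd -` A = (UNIV :: real set) \<times> A" by auto
    then show "emeasure (?U \<Otimes>\<^sub>M ?U) (fst -` A) = emeasure ?U A"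
      "emeasure (?U \<Otimes>\<^sub>M ?U) (snd -` A) = emeasure ?U A"
      using times[OF A, of UNIV] times[OF _ A, of UNIV] by (simp_all add: one)
  qed
  moreover have "restrict (bivariate_cdf (?U \<Otimes>\<^sub>M ?U)) unit_square = (\<lambda>(x, y) \<in> unit_square. x * y)"
  proof (rule restrict_ext, clarify)
    fix x y :: real assume xy: "x \<in> unit_interval" "y \<in> unit_interval"
    have "emeasure ?U {..z} = ennreal z" if "z \<in> unit_interval" for z
    proof -
      have "unit_interval \<inter> {..z} = {0..z}" using that by auto
      then show ?thesis using that by (simp add: U.emeasure_eq_measure uniform_unit_interval)
    qed
    then have "emeasure (?U \<Otimes>\<^sub>M ?U) ({..x} \<times> {..y}) = ennreal (x * y)"
      using xy by (subst times) (simp_all only: ennreal_mult atLeastAtMost_iff borel_closed closed_atMost)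
    then show "bivariate_cdf (?U \<Otimes>\<^sub>M ?U) (x, y) = x * y"
      using xy by (simp add: bivariate_cdf_def measure_def[of "?U \<Otimes>\<^sub>M ?U"])
  qed
  ultimately show ?thesis by simp
qed

text \<open>The mixture is realized as a two-stage experiment: a coin with bias \<open>t\<close>
  selects which of the two laws to sample. Both laws have the same marginals, so these survive the
  mixing.\<close>

lemma copulas_convex:
  assumes C: "C \<in> copulas" and D: "D \<in> copulas" and t: "0 \<le> t" "t \<le> 1"
  obtains E where "E \<in> copulas" "\<And>p. p \<in> unit_square \<Longrightarrow> E p = t * C p + (1 - t) * D p"
proof -
  let ?U = "uniform_measure lborel unit_interval"
  obtain MC where MC: "prob_space MC" "sets MC = sets borel" "C = restrict (bivariate_cdf MC) unit_square"
    "\<And>A. A \<in> sets borel \<Longrightarrow> emeasure MC (fst -` A) = emeasure ?U A"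
    "\<And>A. A \<in> sets borel \<Longrightarrow> emeasure MC (snd -` A) = emeasure ?U A"
    by (rule copula_obtain_measure[OF C]) blast
  obtain MD where MD: "prob_space MD" "sets MD = sets borel" "D = restrict (bivariate_cdf MD) unit_square"
    "\<And>A. A \<in> sets borel \<Longrightarrow> emeasure MD (fst -` A) = emeasure ?U A"
    "\<And>A. A \<in> sets borel \<Longrightarrow> emeasure MD (snd -` A) = emeasure ?U A"
    by (rule copula_obtain_measure[OF D]) blast
  interpret MC: prob_space MC by fact
  interpret MD: prob_space MD by fact
  define f where "f b = (if b then MC else MD)" for b
  define B where "B = measure_pmf (bernoulli_pmf t)"
  define M where "M = B \<bind> f"
  have f: "f \<in> measurable B (prob_algebra borel)"
    by (auto simp: B_def f_def space_prob_algebra MC MD)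
  have B: "B \<in> space (prob_algebra B)"
    by (simp add: B_def space_prob_algebra measure_pmf.prob_space_axioms)
  have pM: "prob_space M" and sM: "sets M = sets borel"
    unfolding M_def by (rule prob_space_bind'[OF B f] sets_bind'[OF B f])+
  have eM: "emeasure M A = emeasure MC A * ennreal t + emeasure MD A * ennreal (1 - t)" if "A \<in> sets borel" for A
    unfolding M_def
    by (subst emeasure_bind[OF _ measurable_prob_algebraD[OF f] that]) (use t in \<open>auto simp: B_def f_def\<close>)
  have mix: "a * ennreal t + a * ennreal (1 - t) = a" for a :: ennreal
    using t by (simp add: distrib_left[symmetric] ennreal_plus[symmetric] del: ennreal_plus)
  have "restrict (bivariate_cdf M) unit_square \<in> copulas"
    by (rule bivariate_cdf_in_copulas[OF pM sM])
      (simp_all add: eM vimage_proj_borel MC(4,5) MD(4,5) mix)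
  moreover have "restrict (bivariate_cdf M) unit_square p = t * C p + (1 - t) * D p" if "p \<in> unit_square" for p
  proof -
    obtain x y where p: "p = (x, y)" by (cases p)
    have "{..x} \<times> {..y} \<in> sets borel" by (simp add: borel_prod[symmetric])
    then have "emeasure M ({..x} \<times> {..y})
        = ennreal (t * measure MC ({..x} \<times> {..y}) + (1 - t) * measure MD ({..x} \<times> {..y}))"
      using t
      by (simp add: eM MC.emeasure_eq_measure MD.emeasure_eq_measure ennreal_mult' ennreal_plus mult.commute)
    then have "measure M ({..x} \<times> {..y}) = t * measure MC ({..x} \<times> {..y}) + (1 - t) * measure MD ({..x} \<times> {..y})"
      using t by (simp add: measure_def[of M] del: ennreal_plus)
    then show ?thesis using that by (simp add: p MC MD bivariate_cdf_def)
  qed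
  ultimately show thesis by (rule that)
qed

text \<open>The copula of the pair with exchanged coordinates. Restricting to the square keeps it
  extensional, as members of \<open>copulas\<close> must be.\<close>

definition swap_copula :: "(real \<times> real \<Rightarrow> real) \<Rightarrow> real \<times> real \<Rightarrow> real" where
  "swap_copula C = (\<lambda>(x, y) \<in> unit_square. C (y, x))"

lemma swap_copula_apply [simp]:
  "x \<in> unit_interval \<Longrightarrow> y \<in> unit_interval \<Longrightarrow> swap_copula C (x, y) = C (y, x)"
  by (simp add: swap_copula_def)

lemma swap_copula_in_copulas:
  assumes "C \<in> copulas" shows "swap_copula C \<in> copulas"
  unfolding swap_copula_def
proof -
  obtain M where M: "prob_space M" "sets M = sets borel" "C = restrict (bivariate_cdf M) unit_square"
    "\<And>A. A \<in> sets borel \<Longrightarrow> emeasure M (fst -` A) = emeasure (uniform_measure lborel unit_interval) A"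
    "\<And>A. A \<in> sets borel \<Longrightarrow> emeasure M (snd -` A) = emeasure (uniform_measure lborel unit_interval) A"
    by (rule copula_obtain_measure[OF assms]) blast
  interpret prob_space M by fact
  have sp: "space M = UNIV"
    using sets_eq_imp_space_eq[OF M(2)] by simp
  have swap: "prod.swap \<in> measurable M borel"
    unfolding measurable_cong_sets[OF M(2) refl]
    by (intro borel_measurable_continuous_onI continuous_on_swap)
  let ?M = "distr M borel prod.swap"
  have "restrict (bivariate_cdf ?M) unit_square \<in> copulas"
  proof (rule bivariate_cdf_in_copulas)
    show "prob_space ?M" by (rule prob_space_distr[OF swap])
    fix A :: "real set" assume A: "A \<in> sets borel"
    have "prod.swap -` (fst -` A) = (snd -` A :: (real \<times> real) set)"
      "prod.swap -` (snd -` A) = (fst -` A :: (real \<times> real) set)" by auto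
    then show "emeasure ?M (fst -` A) = emeasure (uniform_measure lborel unit_interval) A"
      "emeasure ?M (snd -` A) = emeasure (uniform_measure lborel unit_interval) A"
      by (simp_all add: emeasure_distr[OF swap] vimage_proj_borel[OF A] sp M(4,5)[OF A])
  qed simp
  moreover have "restrict (bivariate_cdf ?M) unit_square = (\<lambda>(x, y) \<in> unit_square. C (y, x))"
  proof (rule restrict_ext, clarify)
    fix x y :: real assume xy: "x \<in> unit_interval" "y \<in> unit_interval"
    have "{..x} \<times> {..y} \<in> sets borel" by (simp add: borel_prod[symmetric])
    moreover have "prod.swap -` ({..x} \<times> {..y}) = {..y} \<times> {..x}" by auto
    ultimately show "bivariate_cdf ?M (x, y) = C (y, x)"
      using xy by (simp add: bivariate_cdf_def measure_distr[OF swap] sp M(3))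
  qed
  ultimately show "(\<lambda>(x, y) \<in> unit_square. C (y, x)) \<in> copulas" by simp
qed

lemma swap_swap_copula:
  assumes "C \<in> copulas" shows "swap_copula (swap_copula C) = C"
proof -
  have "C \<in> extensional unit_square" using assms by (auto simp: copulas_def)
  then show ?thesis
    by (intro extensionalityI[of _ unit_square]) (auto simp: swap_copula_def)
qed


section \<open>The topology of uniform convergence\<close>

lemma copula_value_bounds:
  assumes "C \<in> copulas" "p \<in> unit_square" shows "C p \<in> {0..1}"
proof -
  interpret copula C by unfold_locales fact
  obtain x y where p: "p = (x, y)" "x \<in> unit_interval" "y \<in> unit_interval"
    using assms(2) by blast
  then show ?thesis
    using measure_copula_measure[of x y] prob_le_1[of "{0..x} \<times> {0..y}"]
      measure_nonneg[of \<mu> "{0..x} \<times> {0..y}"] by simp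
qed

lemma abs_diff_le_mdist_copula:
  assumes "A \<in> copulas" "B \<in> copulas" "p \<in> unit_square"
  shows "\<bar>A p - B p\<bar> \<le> mdist copula_metric A B"
proof -
  have "bdd_above ((\<lambda>p. \<bar>A p - B p\<bar>) ` unit_square)"
  proof (rule bdd_aboveI2)
    fix q assume "q \<in> unit_square"
    then show "\<bar>A q - B q\<bar> \<le> 1"
      using copula_value_bounds[OF assms(1), of q] copula_value_bounds[OF assms(2), of q]
      by (auto simp: abs_le_iff)
  qed
  then show ?thesis
    unfolding mdist_copula_metric[OF assms(1,2)] by (rule cSUP_upper[OF assms(3)])
qed

lemma mdist_copula_le:
  assumes "A \<in> copulas" "B \<in> copulas" "\<And>p. p \<in> unit_square \<Longrightarrow> \<bar>A p - B p\<bar> \<le> r"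
  shows "mdist copula_metric A B \<le> r"
  unfolding mdist_copula_metric[OF assms(1,2)]
  by (rule cSUP_least) (use assms(3) in auto)

text \<open>Evaluation at a point is 1-Lipschitz for the supremum metric. Hence strict inequalities
  between finitely many values of \<open>C\<close> are open conditions.\<close>

lemma continuous_map_copula_eval:
  assumes "p \<in> unit_square"
  shows "continuous_map (mtopology_of copula_metric) euclideanreal (\<lambda>C. C p)"
proof -
  have "Lipschitz_continuous_map copula_metric euclidean_metric (\<lambda>C. C p)"
    unfolding Lipschitz_continuous_map_def
    using abs_diff_le_mdist_copula[OF _ _ assms]
    by (auto simp: dist_real_def intro!: exI[of _ 1])
  then show ?thesis
    using Lipschitz_continuous_imp_continuous_map by fastforce
qed

lemma openin_copula_less:
  assumes "continuous_map (mtopology_of copula_metric) euclideanreal \<phi>"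
  shows "openin (mtopology_of copula_metric) {C \<in> copulas. \<phi> C < e}"
  using openin_continuous_map_preimage[OF assms, of "{..<e}"] by simp

text \<open>The complement of an open dense set is closed with empty interior. Density is phrased by
  pointwise bounds, the form in which the approximations are obtained.\<close>

lemma nowhere_dense_in_complement:
  assumes U: "openin (mtopology_of copula_metric) U"
    and dense: "\<And>C e. C \<in> copulas \<Longrightarrow> 0 < e \<Longrightarrow>
      \<exists>D \<in> U. \<forall>p \<in> unit_square. \<bar>C p - D p\<bar> \<le> e"
  shows "nowhere_dense_in (mtopology_of copula_metric) (copulas - U)"
proof -
  let ?X = "mtopology_of copula_metric"
  have U_sub: "U \<subseteq> copulas" using openin_subset[OF U] by simp
  have "closedin ?X (copulas - U)"
    using U by (metis closedin_diff closedin_topspace mspace_copula_metric topspace_mtopology_of)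
  then have cl: "?X closure_of (copulas - U) = copulas - U"
    by (rule closure_of_closedin)
  have "?X interior_of (copulas - U) = {}"
  proof (rule ccontr)
    assume "?X interior_of (copulas - U) \<noteq> {}"
    then obtain C where C: "C \<in> ?X interior_of (copulas - U)" by blast
    have "openin ?X (?X interior_of (copulas - U))" by simp
    then obtain r where r: "0 < r" "mball_of copula_metric C r \<subseteq> ?X interior_of (copulas - U)"
      using C unfolding mtopology_of_def mball_of_def
      by (metis Metric_space.openin_mtopology Metric_space_mspace_mdist)
    have Cc: "C \<in> copulas" using C interior_of_subset by fastforce
    \<comment> \<open>Half the radius, since non-strict pointwise bounds must give a distance
      strictly below \<open>r\<close>.\<close>
    obtain D where D: "D \<in> U" "\<And>p. p \<in> unit_square \<Longrightarrow> \<bar>C p - D p\<bar> \<le> r / 2"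
      using dense[OF Cc, of "r / 2"] r(1) by auto
    have "mdist copula_metric C D \<le> r / 2"
      using Cc D U_sub by (intro mdist_copula_le) auto
    then have "D \<in> mball_of copula_metric C r"
      using Cc D(1) U_sub r(1) by auto
    then show False
      using r(2) D(1) interior_of_subset[of ?X "copulas - U"] by blast
  qed
  then show ?thesis
    unfolding nowhere_dense_in_def cl by simp
qed


section \<open>Almost functional dependence\<close>

text \<open>For \<open>B = \<Union>i<N. {i / N<..v i}\<close>, the last inequality bounds \<open>\<mu>\<^sub>C\<close> of the symmetric
  difference of \<open>{Y \<le> y}\<close> and \<open>{X \<in> B}\<close>, in terms of finitely many values of \<open>C\<close> only.\<close>

definition nearly_determined :: "real \<Rightarrow> real \<Rightarrow> (real \<times> real \<Rightarrow> real) set" where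
  "nearly_determined y e = {C \<in> copulas. \<exists>N v. 0 < N \<and>
     (\<forall>i<N. real i / real N \<le> v i \<and> v i \<le> real (Suc i) / real N) \<and>
     y + (\<Sum>i<N. v i - real i / real N) - 2 * (\<Sum>i<N. C (v i, y) - C (real i / real N, y)) < e}"

lemma grid_unit_interval:
  assumes "i < N" "real i / real N \<le> v" "v \<le> real (Suc i) / real N"
  shows "real i / real N \<in> unit_interval" "v \<in> unit_interval"
proof -
  have "real (Suc i) / real N \<le> 1" "real i / real N \<le> 1" "0 \<le> real i / real N"
    using assms(1) by (simp_all add: divide_simps)
  then show "real i / real N \<in> unit_interval" "v \<in> unit_interval"
    using assms(2,3) unfolding atLeastAtMost_iff by linarith+
qed

text \<open>The set is a union, over all grids and endpoints \<open>v\<close>, of sets given by one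
  strict inequality in finitely many values of \<open>C\<close>.\<close>

lemma openin_nearly_determined:
  assumes y: "y \<in> unit_interval"
  shows "openin (mtopology_of copula_metric) (nearly_determined y e)"
proof -
  define P where "P N v \<longleftrightarrow> 0 < N \<and> (\<forall>i<N. real i / real N \<le> v i \<and> v i \<le> real (Suc i) / real N)"
    for N and v :: "nat \<Rightarrow> real"
  define \<phi> where "\<phi> N v C =
    y + (\<Sum>i<N. v i - real i / real N) - 2 * (\<Sum>i<N. C (v i, y) - C (real i / real N, y))"
    for N v and C :: "real \<times> real \<Rightarrow> real"
  have "openin (mtopology_of copula_metric) {C \<in> copulas. \<phi> N v C < e}" if "P N v" for N v
  proof (rule openin_copula_less)
    have "(v i, y) \<in> unit_square" "(real i / real N, y) \<in> unit_square" if "i < N" for i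
      using grid_unit_interval[OF that] \<open>P N v\<close> that y by (auto simp: P_def)
    then show "continuous_map (mtopology_of copula_metric) euclideanreal (\<phi> N v)"
      unfolding \<phi>_def
      by (intro continuous_map_diff continuous_map_real_mult_left continuous_map_sum
          continuous_map_copula_eval) (auto simp: continuous_map_const)
  qed
  moreover have "nearly_determined y e = (\<Union>(N, v) \<in> {(N, v). P N v}. {C \<in> copulas. \<phi> N v C < e})"
    by (auto simp: nearly_determined_def P_def \<phi>_def)
  ultimately show ?thesis
    by (auto intro!: openin_Union)
qed

text \<open>For the rearranged copula take \<open>v i\<close> as the right end of the interval in
  strip \<open>i\<close> where \<open>Y\<close> is at most \<open>y\<close>. Both sums then
  telescope to \<open>y\<close>, and the error is \<open>y + y - 2 * y = 0\<close>.\<close>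

lemma nearly_determined_dense:
  assumes C: "C \<in> copulas" and y: "y \<in> unit_interval" and "0 < e" "0 < r"
  shows "\<exists>D \<in> nearly_determined y e. \<forall>p \<in> unit_square. \<bar>C p - D p\<bar> \<le> r"
proof -
  interpret C: copula C by unfold_locales fact
  obtain n where n: "1 / real (Suc n) < r"
    using \<open>0 < r\<close> reals_Archimedean[of r] by (auto simp: inverse_eq_divide)
  define N where "N = Suc n"
  have N: "0 < N" by (simp add: N_def)
  define p where "p i = real i / real N" for i
  obtain D where D: "D \<in> copulas"
    and grid: "\<And>i y. i \<le> N \<Longrightarrow> y \<in> unit_interval \<Longrightarrow> D (p i, y) = C (p i, y)"
    and row: "\<And>i y. i < N \<Longrightarrow> y \<in> unit_interval \<Longrightarrow>
      D (p i + (C (p (Suc i), y) - C (p i, y)), y) - C (p i, y) = C (p (Suc i), y) - C (p i, y)"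
    unfolding p_def by (rule C.functional_approximation[OF N]) blast
  define v where "v i = p i + (C (p (Suc i), y) - C (p i, y))" for i
  have p: "0 \<le> p i" "p i \<le> p (Suc i)" for i
    using N by (auto simp: p_def divide_right_mono)
  have p1: "p (Suc i) \<le> 1" if "i < N" for i
    using that by (simp add: p_def)
  have v: "p i \<le> v i \<and> v i \<le> p (Suc i)" if "i < N" for i
    using C.copula_strip_bounds[OF p(1)[of i] p(2)[of i] p1[OF that] y] by (auto simp: v_def)
  have sum_v: "(\<Sum>i<N. v i - p i) = y"
  proof -
    have "(\<Sum>i<N. v i - p i) = (\<Sum>i<N. C (p (Suc i), y) - C (p i, y))"
      by (simp add: v_def)
    also have "\<dots> = C (p N, y) - C (p 0, y)"
      by (rule sum_lessThan_telescope)
    also have "\<dots> = y"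
      using N y by (simp add: p_def C.copula_1_left C.copula_0_left)
    finally show ?thesis .
  qed
  have "(\<Sum>i<N. D (v i, y) - D (p i, y)) = (\<Sum>i<N. v i - p i)"
  proof (rule sum.cong)
    fix i assume "i \<in> {..<N}"
    then show "D (v i, y) - D (p i, y) = v i - p i"
      using row[of i y] grid[of i y] y by (simp add: v_def)
  qed simp
  then have "y + (\<Sum>i<N. v i - p i) - 2 * (\<Sum>i<N. D (v i, y) - D (p i, y)) < e"
    using sum_v \<open>0 < e\<close> by simp
  then have "D \<in> nearly_determined y e"
    using D N v unfolding nearly_determined_def p_def by blast
  moreover have "\<bar>C q - D q\<bar> \<le> r" if q: "q \<in> unit_square" for q
  proof -
    obtain a b where ab: "q = (a, b)" "a \<in> unit_interval" "b \<in> unit_interval" using q by blast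
    have "\<bar>C (a, b) - D (a, b)\<bar> \<le> 1 / real N"
      by (rule copulas_close_of_grid[OF C D N grid[unfolded p_def] ab(2,3)])
    then show ?thesis using n ab by (simp add: N_def)
  qed
  ultimately show ?thesis by blast
qed

section \<open>From near determination to functional dependence, and exchange of coordinates\<close>

context copula
begin

text \<open>The intervals are disjoint, so the strip formula sums over them. The symmetric
  difference has mass at most the sum of both events minus twice their intersection.\<close>

lemma event_approximation:
  assumes y: "y \<in> unit_interval" and near: "C \<in> nearly_determined y e"
  shows "\<exists>B \<in> sets borel. prob {\<omega> \<in> space \<mu>. (snd \<omega> \<le> y) \<noteq> (fst \<omega> \<in> B)} < e"
proof -
  obtain N v where N: "0 < N"
    and v: "\<And>i. i < N \<Longrightarrow> real i / real N \<le> v i \<and> v i \<le> real (Suc i) / real N"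
    and e: "y + (\<Sum>i<N. v i - real i / real N) - 2 * (\<Sum>i<N. C (v i, y) - C (real i / real N, y)) < e"
    using near unfolding nearly_determined_def by blast
  define J where "J i = {real i / real N<..v i}" for i
  define B where "B = (\<Union>i<N. J i)"
  have J: "J i \<in> sets borel" "J i \<subseteq> unit_interval" if "i < N" for i
    using grid_unit_interval[OF that] v[OF that] by (auto simp: J_def)
  then have B: "B \<in> sets borel" "B \<subseteq> unit_interval" by (auto simp: B_def)
  have disj: "disjoint_family_on J {..<N}"
  proof -
    have False if "i < j" "j < N" "x \<in> J i" "x \<in> J j" for i j x
    proof -
      have "real (Suc i) / real N \<le> real j / real N"
        using that by (intro divide_right_mono) auto
      then show False using that v[of i] by (auto simp: J_def)
    qed
    then show ?thesis
      unfolding disjoint_family_on_def by (metis disjoint_iff lessThan_iff linorder_neqE_nat)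
  qed
  have prob_B: "prob (B \<times> {0..z}) = (\<Sum>i<N. C (v i, z) - C (real i / real N, z))"
    if z: "z \<in> unit_interval" for z
  proof -
    have "B \<times> {0..z} = (\<Union>i<N. J i \<times> {0..z})" by (auto simp: B_def)
    also have "prob \<dots> = (\<Sum>i<N. prob (J i \<times> {0..z}))"
    proof (rule finite_measure_finite_Union)
      show "disjoint_family_on (\<lambda>i. J i \<times> {0..z}) {..<N}"
        using disj by (auto simp: disjoint_family_on_def)
      show "(\<lambda>i. J i \<times> {0..z}) ` {..<N} \<subseteq> events"
        using J z by (auto intro!: Times_sets_\<mu>)
    qed simp
    also have "\<dots> = (\<Sum>i<N. C (v i, z) - C (real i / real N, z))"
    proof (rule sum.cong)
      fix i assume "i \<in> {..<N}"
      then have i: "i < N" by simp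
      show "prob (J i \<times> {0..z}) = C (v i, z) - C (real i / real N, z)"
        unfolding J_def using grid_unit_interval[OF i] v[OF i] z by (intro prob_strip) auto
    qed simp
    finally show ?thesis .
  qed
  \<comment> \<open>This is the previous formula at height 1, where
    \<open>C (x, 1) = x\<close>.\<close>
  have prob_B1: "prob (B \<times> unit_interval) = (\<Sum>i<N. v i - real i / real N)"
    unfolding prob_B[of 1, simplified]
    by (intro sum.cong) (use grid_unit_interval v in \<open>auto simp: copula_1_right\<close>)
  let ?S = "unit_interval \<times> {0..y}" and ?T = "B \<times> unit_interval" and ?I = "B \<times> {0..y}"
  have ev: "?S \<in> events" "?T \<in> events" "?I \<in> events"
    using B y by (auto intro!: Times_sets_\<mu>)
  have sub: "?I \<subseteq> ?S" "?I \<subseteq> ?T" using B y by auto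
  have "{\<omega> \<in> space \<mu>. (snd \<omega> \<le> y) \<noteq> (fst \<omega> \<in> B)} = (?S - ?I) \<union> (?T - ?I)"
    using B y by auto
  then have "prob {\<omega> \<in> space \<mu>. (snd \<omega> \<le> y) \<noteq> (fst \<omega> \<in> B)} \<le> prob (?S - ?I) + prob (?T - ?I)"
    using measure_Un_le[of "?S - ?I" \<mu> "?T - ?I"] ev by simp
  also have "\<dots> = (prob ?S - prob ?I) + (prob ?T - prob ?I)"
    using ev sub by (simp add: finite_measure_Diff)
  also have "\<dots> = y + (\<Sum>i<N. v i - real i / real N) - 2 * (\<Sum>i<N. C (v i, y) - C (real i / real N, y))"
    using prob_snd[of "{0..y}"] y by (simp add: prob_B prob_B1)
  finally show ?thesis using e B(1) by force
qed

text \<open>Rational levels outside \<open>[0, 1]\<close> give trivial events, represented by the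
  empty set or the whole line; the others are covered by the hypothesis.\<close>

lemma functional_dependence:
  assumes near: "\<And>q n. q \<in> \<rat> \<inter> unit_interval \<Longrightarrow> C \<in> nearly_determined q (1 / real (Suc n))"
  shows "\<exists>h \<in> borel_measurable borel. (\<forall>x. h x \<in> unit_interval) \<and> (AE \<omega> in \<mu>. snd \<omega> = h (fst \<omega>))"
proof -
  have "\<exists>h \<in> borel_measurable borel. AE \<omega> in \<mu>. snd \<omega> = h (fst \<omega>)"
  proof (rule rv_function_of_rv)
    fix q e :: real assume q: "q \<in> \<rat>" and e: "0 < e"
    consider "q < 0" | "1 < q" | "q \<in> unit_interval" by fastforce
    then show "\<exists>B \<in> sets borel. prob {\<omega> \<in> space \<mu>. (snd \<omega> \<le> q) \<noteq> (fst \<omega> \<in> B)} < e"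
    proof cases
      case 1
      then have *: "{\<omega> \<in> space \<mu>. (snd \<omega> \<le> q) \<noteq> (fst \<omega> \<in> {})} = {}" by auto
      show ?thesis
      proof (rule bexI[of _ "{}"])
        show "prob {\<omega> \<in> space \<mu>. (snd \<omega> \<le> q) \<noteq> (fst \<omega> \<in> {})} < e"
          unfolding * using e by simp
      qed simp
    next
      case 2
      then have *: "{\<omega> \<in> space \<mu>. (snd \<omega> \<le> q) \<noteq> (fst \<omega> \<in> UNIV)} = {}" by auto
      show ?thesis
      proof (rule bexI[of _ UNIV])
        show "prob {\<omega> \<in> space \<mu>. (snd \<omega> \<le> q) \<noteq> (fst \<omega> \<in> UNIV)} < e"
          unfolding * using e by simp
      qed simp
    next
      case 3
      obtain n where n: "1 / real (Suc n) < e"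
        using e reals_Archimedean[of e] by (auto simp: inverse_eq_divide)
      obtain B where "B \<in> sets borel"
        "prob {\<omega> \<in> space \<mu>. (snd \<omega> \<le> q) \<noteq> (fst \<omega> \<in> B)} < 1 / real (Suc n)"
        using event_approximation[OF 3 near[of q n]] q 3 by blast
      then show ?thesis using n by (intro bexI[of _ B]) (simp_all only: order.strict_trans)
    qed
  qed simp_all
  then obtain h where [measurable]: "h \<in> borel_measurable borel" and h: "AE \<omega> in \<mu>. snd \<omega> = h (fst \<omega>)"
    by blast
  \<comment> \<open>Clamping makes all values lie in the unit interval and changes nothing almost
    surely, since \<open>Y\<close> is there already.\<close>
  have "AE \<omega> in \<mu>. snd \<omega> = max 0 (min 1 (h (fst \<omega>)))"
    using h AE_space by eventually_elim auto
  then show ?thesis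
    by (intro bexI[of _ "\<lambda>x. max 0 (min 1 (h x))"]) auto
qed

text \<open>The image measure is doubly stochastic and has the right values on anchored rectangles,
  so uniqueness identifies it.\<close>

lemma copula_measure_swap:
  "copula_measure (swap_copula C) = distr \<mu> (restrict_space borel unit_square) prod.swap"
proof (rule copula_measure_unique)
  let ?R = "restrict_space borel unit_square :: (real \<times> real) measure"
  interpret S: copula "swap_copula C"
    by unfold_locales (rule swap_copula_in_copulas[OF copula])
  have s: "sets \<mu> = sets ?R"
    using doubly_stochastic_copula_measure by (simp add: doubly_stochastic_def)
  have swap: "prod.swap \<in> measurable \<mu> ?R"
    unfolding measurable_cong_sets[OF s refl]
    by (intro measurable_restrict_space3 borel_measurable_continuous_onI continuous_on_swap) auto
  have proj: "fst \<in> measurable ?R leb_unit" "snd \<in> measurable ?R leb_unit"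
    by (rule measurable_proj_unit[OF refl])+
  have "fst \<circ> prod.swap = (snd :: real \<times> real \<Rightarrow> real)"
    "snd \<circ> prod.swap = (fst :: real \<times> real \<Rightarrow> real)" by auto
  then show "doubly_stochastic (distr \<mu> ?R prod.swap)"
    by (simp add: doubly_stochastic_def distr_distr[OF proj(1) swap] distr_distr[OF proj(2) swap] distr_\<mu>)
  show "doubly_stochastic (copula_measure (swap_copula C))"
    by (rule S.doubly_stochastic_copula_measure)
  fix x y :: real assume xy: "x \<in> unit_interval" "y \<in> unit_interval"
  have "prod.swap -` ({0..x} \<times> {0..y}) \<inter> space \<mu> = {0..y} \<times> {0..x}"
    using xy by auto
  moreover have "{0..x} \<times> {0..y} \<in> sets ?R"
    using Times_sets_\<mu>[of "{0..x}" "{0..y}"] xy s by auto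
  ultimately show "measure (copula_measure (swap_copula C)) ({0..x} \<times> {0..y})
      = measure (distr \<mu> ?R prod.swap) ({0..x} \<times> {0..y})"
    using xy by (simp add: measure_distr[OF swap] measure_copula_measure S.measure_copula_measure)
qed

lemma AE_fst:
  assumes "AE \<omega> in \<mu>. P (fst \<omega>)" "{x \<in> unit_interval. P x} \<in> sets borel"
  shows "AE x in leb_unit. P x"
proof -
  have "{x \<in> space leb_unit. P x} \<in> sets leb_unit"
    using assms(2) by (auto simp: sets_leb_unit_iff)
  then have "(AE x in distr \<mu> leb_unit fst. P x) \<longleftrightarrow> (AE \<omega> in \<mu>. P (fst \<omega>))"
    by (intro AE_distr_iff measurable_\<mu>_leb_unit)
  then show ?thesis using assms(1) unfolding distr_\<mu> by blast
qed

lemma AE_fst':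
  assumes "AE x in leb_unit. P x" shows "AE \<omega> in \<mu>. P (fst \<omega>)"
  using AE_distrD[OF measurable_\<mu>_leb_unit(1), of P] assms unfolding distr_\<mu> by blast

text \<open>Almost surely \<open>Y = h X\<close>, so the law of \<open>Y\<close> is the image under
  \<open>h\<close> of the law of \<open>X\<close>; both laws are uniform.\<close>

lemma leb_preserving_of_dependence:
  assumes [measurable]: "h \<in> borel_measurable borel"
    and into: "\<And>x. x \<in> unit_interval \<Longrightarrow> h x \<in> unit_interval"
    and ae: "AE \<omega> in \<mu>. snd \<omega> = h (fst \<omega>)"
  shows "leb_preserving h"
proof -
  have h: "h \<in> measurable leb_unit leb_unit"
    by (rule measurable_leb_unit) (use into in auto)
  have "distr \<mu> leb_unit snd = distr \<mu> leb_unit (h \<circ> fst)"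
    by (rule distr_cong_AE)
      (use ae measurable_\<mu>_leb_unit measurable_comp[OF measurable_\<mu>_leb_unit(1) h] in auto)
  also have "\<dots> = distr leb_unit leb_unit h"
    by (simp add: distr_distr[OF h measurable_\<mu>_leb_unit(1), symmetric] distr_\<mu>)
  finally have "distr leb_unit leb_unit h = leb_unit" by (simp add: distr_\<mu>)
  then show ?thesis
    using h emeasure_distr[OF h] by (auto simp: leb_preserving_def)
qed

end


section \<open>Typical copulas\<close>

text \<open>Exchanging coordinates does not increase the supremum distance, so the set is a preimage
  of an open set under a continuous map.\<close>

lemma openin_swap_nearly_determined:
  assumes "y \<in> unit_interval"
  shows "openin (mtopology_of copula_metric) {C \<in> copulas. swap_copula C \<in> nearly_determined y e}"
proof -
  have "mdist copula_metric (swap_copula A) (swap_copula B) \<le> mdist copula_metric A B"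
    if "A \<in> copulas" "B \<in> copulas" for A B
  proof (rule mdist_copula_le)
    fix p assume "p \<in> unit_square"
    then show "\<bar>swap_copula A p - swap_copula B p\<bar> \<le> mdist copula_metric A B"
      using abs_diff_le_mdist_copula[OF that, of "prod.swap p"] by auto
  qed (use that swap_copula_in_copulas in auto)
  then have "Lipschitz_continuous_map copula_metric copula_metric swap_copula"
    unfolding Lipschitz_continuous_map_def
    by (auto simp: swap_copula_in_copulas intro!: exI[of _ 1])
  then have "continuous_map (mtopology_of copula_metric) (mtopology_of copula_metric) swap_copula"
    by (rule Lipschitz_continuous_imp_continuous_map)
  from openin_continuous_map_preimage[OF this openin_nearly_determined[OF assms]]
  show ?thesis by simp
qed

text \<open>Approximate the exchanged copula and exchange back.\<close>

lemma swap_nearly_determined_dense: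
  assumes C: "C \<in> copulas" and "y \<in> unit_interval" "0 < e" "0 < r"
  shows "\<exists>D \<in> {C \<in> copulas. swap_copula C \<in> nearly_determined y e}.
    \<forall>p \<in> unit_square. \<bar>C p - D p\<bar> \<le> r"
proof -
  obtain D where D: "D \<in> nearly_determined y e"
    and close: "\<And>p. p \<in> unit_square \<Longrightarrow> \<bar>swap_copula C p - D p\<bar> \<le> r"
    using nearly_determined_dense[OF swap_copula_in_copulas[OF C] assms(2-4)] by blast
  have Dc: "D \<in> copulas" using D by (simp add: nearly_determined_def)
  have "\<bar>C p - swap_copula D p\<bar> \<le> r" if "p \<in> unit_square" for p
    using close[of "prod.swap p"] that by auto
  then show ?thesis
    using D by (intro bexI[of _ "swap_copula D"]) (auto simp: swap_copula_in_copulas[OF Dc] swap_swap_copula[OF Dc])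
qed

text \<open>By \<open>prob_rectangle\<close> this says that the rectangle
  \<open>{a<..b} \<times> {c<..d}\<close> has positive mass, for nondegenerate rectangles in the
  unit square.\<close>

definition charging :: "real \<Rightarrow> real \<Rightarrow> real \<Rightarrow> real \<Rightarrow> (real \<times> real \<Rightarrow> real) set" where
  "charging a b c d = {C \<in> copulas. C (b, c) - C (a, c) < C (b, d) - C (a, d)}"

lemma openin_charging:
  assumes "a \<in> unit_interval" "b \<in> unit_interval" "c \<in> unit_interval" "d \<in> unit_interval"
  shows "openin (mtopology_of copula_metric) (charging a b c d)"
proof -
  have "openin (mtopology_of copula_metric)
      {C \<in> copulas. (C (b, c) - C (a, c)) - (C (b, d) - C (a, d)) < 0}"
    by (intro openin_copula_less continuous_map_diff continuous_map_copula_eval) (use assms in auto)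
  then show ?thesis by (simp add: charging_def)
qed

text \<open>Mixing in the product copula with weight \<open>t = min 1 r\<close> adds mass
  \<open>t * (b - a) * (d - c)\<close> to the rectangle and moves no value of \<open>C\<close> by
  more than \<open>t\<close>.\<close>

lemma charging_dense:
  assumes C: "C \<in> copulas" and ab: "0 \<le> a" "a < b" "b \<le> 1" and cd: "0 \<le> c" "c < d" "d \<le> 1"
    and r: "0 < r"
  shows "\<exists>D \<in> charging a b c d. \<forall>p \<in> unit_square. \<bar>C p - D p\<bar> \<le> r"
proof -
  interpret copula C by unfold_locales fact
  define P where "P = (\<lambda>(x, y) \<in> unit_square. x * y :: real)"
  have P: "P \<in> copulas" unfolding P_def by (rule product_copula)
  define t where "t = min 1 r"
  have t: "0 < t" "t \<le> 1" "t \<le> r" using r by (auto simp: t_def)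
  obtain E where E: "E \<in> copulas" "\<And>p. p \<in> unit_square \<Longrightarrow> E p = t * P p + (1 - t) * C p"
    by (rule copulas_convex[OF P C, of t]) (use t in auto)
  have "(E (b, d) - E (a, d)) - (E (b, c) - E (a, c))
      = t * ((b - a) * (d - c)) + (1 - t) * ((C (b, d) - C (a, d)) - (C (b, c) - C (a, c)))"
    using ab cd by (simp add: E(2) P_def algebra_simps)
  moreover have "0 < t * ((b - a) * (d - c))"
    using t ab cd by simp
  moreover have "0 \<le> (1 - t) * ((C (b, d) - C (a, d)) - (C (b, c) - C (a, c)))"
    using t ab cd copula_strip_mono(1)[of a b c d] by (intro mult_nonneg_nonneg) auto
  ultimately have "E \<in> charging a b c d"
    using E(1) by (simp add: charging_def)
  moreover have "\<bar>C p - E p\<bar> \<le> r" if "p \<in> unit_square" for p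
  proof -
    have "C p - E p = t * (C p - P p)"
      using E(2)[OF that] by (simp add: algebra_simps)
    moreover have "\<bar>C p - P p\<bar> \<le> 1"
      using copula_value_bounds[OF C that] copula_value_bounds[OF P that] by (auto simp: abs_le_iff)
    ultimately have "\<bar>C p - E p\<bar> \<le> t * 1"
      using t by (simp only: abs_mult) (intro mult_mono, auto)
    then show ?thesis using t by simp
  qed
  ultimately show ?thesis by blast
qed

lemma rational_subinterval:
  assumes "open A" "x \<in> A" "x \<in> unit_interval"
  obtains a b where "a \<in> \<rat>" "b \<in> \<rat>" "0 \<le> a" "a < b" "b \<le> 1" "{a<..b} \<subseteq> A"
proof -
  obtain e where e: "0 < e" "ball x e \<subseteq> A"
    using assms(1,2) by (auto simp: open_contains_ball)
  \<comment> \<open>Clipping to \<open>[0, 1]\<close> still leaves an interval of positive length,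
    even if \<open>x\<close> is an endpoint.\<close>
  have "max 0 (x - e) < min 1 (x + e)" using assms(3) e by auto
  then obtain b where b: "b \<in> \<rat>" "max 0 (x - e) < b" "b < min 1 (x + e)"
    using Rats_dense_in_real by blast
  then obtain a where a: "a \<in> \<rat>" "max 0 (x - e) < a" "a < b"
    using Rats_dense_in_real by blast
  have "{a<..b} \<subseteq> ball x e" using a b by (auto simp: dist_real_def)
  then show thesis using a b e by (intro that[of a b]) auto
qed

section \<open>Deriving the two typical properties from countably many conditions\<close>

context copula
begin

text \<open>The two families of conditions give \<open>Y = h X\<close> and \<open>X = g Y\<close>
  almost surely. Substituting one into the other makes \<open>h\<close> and \<open>g\<close> inverse
  almost everywhere, so \<open>h\<close> can be replaced by a bijection.\<close>

lemma mutually_completely_dependent_of_nearly_determined: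
  assumes "\<And>q n. q \<in> \<rat> \<inter> unit_interval \<Longrightarrow> C \<in> nearly_determined q (1 / real (Suc n))"
    and "\<And>q n. q \<in> \<rat> \<inter> unit_interval \<Longrightarrow> swap_copula C \<in> nearly_determined q (1 / real (Suc n))"
  shows "mutually_completely_dependent C"
proof -
  interpret S: copula "swap_copula C"
    by unfold_locales (rule swap_copula_in_copulas[OF copula])
  obtain h where h [measurable]: "h \<in> borel_measurable borel" and h_unit: "\<And>x. h x \<in> unit_interval"
    and h_ae: "AE \<omega> in \<mu>. snd \<omega> = h (fst \<omega>)"
    using functional_dependence[OF assms(1)] by blast
  obtain g where g [measurable]: "g \<in> borel_measurable borel" and g_unit: "\<And>x. g x \<in> unit_interval"
    and g_ae: "AE \<omega> in copula_measure (swap_copula C). snd \<omega> = g (fst \<omega>)"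
    using S.functional_dependence[OF assms(2)] by blast
  \<comment> \<open>Stated for a general copula because it is applied both to \<open>C\<close> and
    to its exchanged version.\<close>
  have swap: "AE \<omega> in \<nu>. P (prod.swap \<omega>)"
    if "copula D" "\<nu> = copula_measure D" "AE \<omega> in copula_measure (swap_copula D). P \<omega>" for D \<nu> P
  proof -
    interpret D: copula D by fact
    have s: "sets D.\<mu> = sets (restrict_space borel unit_square)"
      using D.doubly_stochastic_copula_measure by (simp add: doubly_stochastic_def)
    have "prod.swap \<in> measurable D.\<mu> (restrict_space borel unit_square)"
      unfolding measurable_cong_sets[OF s refl]
      by (intro measurable_restrict_space3 borel_measurable_continuous_onI continuous_on_swap) auto
    then show ?thesis
      using that(3) unfolding D.copula_measure_swap that(2) by (rule AE_distrD)
  qed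
  have "copula C" "copula (swap_copula C)" by unfold_locales
  have g_ae': "AE \<omega> in \<mu>. fst \<omega> = g (snd \<omega>)"
    using swap[OF \<open>copula C\<close> refl g_ae] by simp
  have h_ae': "AE \<omega> in copula_measure (swap_copula C). fst \<omega> = h (snd \<omega>)"
    using swap[OF \<open>copula (swap_copula C)\<close> refl, of "\<lambda>\<omega>. snd \<omega> = h (fst \<omega>)"] h_ae
    unfolding swap_swap_copula[OF copula] by simp
  have "AE \<omega> in \<mu>. g (h (fst \<omega>)) = fst \<omega>"
    using h_ae g_ae' by eventually_elim simp
  then have gh: "AE x in leb_unit. g (h x) = x"
    by (rule AE_fst) measurable
  have "AE \<omega> in copula_measure (swap_copula C). h (g (fst \<omega>)) = fst \<omega>"
    using g_ae h_ae' by eventually_elim simp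
  then have hg: "AE x in leb_unit. h (g x) = x"
    by (rule S.AE_fst) measurable
  have "leb_preserving h" "leb_preserving g"
    using leb_preserving_of_dependence[OF h h_unit h_ae] S.leb_preserving_of_dependence[OF g g_unit g_ae]
    by blast+
  then obtain \<phi> where \<phi>: "\<phi> \<in> borel_measurable borel" "bij_betw \<phi> unit_interval unit_interval"
      "AE x in leb_unit. \<phi> x = h x"
    by (rule leb_preserving_bijective_modification[OF _ _ h g h_unit g_unit gh hg])
  \<comment> \<open>Changing \<open>h\<close> on a null set of first coordinates affects only a null
    set of the square, so the mass stays on the graph.\<close>
  have ae: "AE \<omega> in \<mu>. snd \<omega> = \<phi> (fst \<omega>)"
    using h_ae AE_fst'[OF \<phi>(3)] by eventually_elim simp
  have "leb_preserving \<phi>"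
    by (rule leb_preserving_of_dependence[OF \<phi>(1) _ ae]) (use \<phi>(2) in \<open>auto simp: bij_betw_def\<close>)
  with ae have "completely_dependent_via C \<phi>"
    by (simp add: completely_dependent_via_def case_prod_beta')
  with \<phi>(2) show ?thesis
    unfolding mutually_completely_dependent_def by blast
qed

text \<open>An open set meeting the square contains a half-open rational rectangle inside the
  square, which carries positive mass.\<close>

lemma full_support_of_charging:
  assumes "\<And>a b c d. a \<in> \<rat> \<Longrightarrow> b \<in> \<rat> \<Longrightarrow> c \<in> \<rat> \<Longrightarrow> d \<in> \<rat> \<Longrightarrow> 0 \<le> a \<Longrightarrow> a < b \<Longrightarrow> b \<le> 1 \<Longrightarrow>
    0 \<le> c \<Longrightarrow> c < d \<Longrightarrow> d \<le> 1 \<Longrightarrow> C \<in> charging a b c d"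
  shows "measure_support \<mu> = unit_square"
proof -
  have "U \<inter> unit_square = {}" if U: "open U" "emeasure \<mu> (U \<inter> unit_square) = 0" for U
  proof (rule ccontr)
    assume "U \<inter> unit_square \<noteq> {}"
    then obtain x y where xy: "(x, y) \<in> U" "x \<in> unit_interval" "y \<in> unit_interval" by blast
    obtain A B where AB: "open A" "open B" "(x, y) \<in> A \<times> B" "A \<times> B \<subseteq> U"
      using open_prod_elim[OF U(1) xy(1)] by blast
    obtain a b where ab: "a \<in> \<rat>" "b \<in> \<rat>" "0 \<le> a" "a < b" "b \<le> 1" "{a<..b} \<subseteq> A"
      using rational_subinterval[OF AB(1) _ xy(2)] AB(3) by blast
    obtain c d where cd: "c \<in> \<rat>" "d \<in> \<rat>" "0 \<le> c" "c < d" "d \<le> 1" "{c<..d} \<subseteq> B"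
      using rational_subinterval[OF AB(2) _ xy(3)] AB(3) by blast
    have "0 < (C (b, d) - C (a, d)) - (C (b, c) - C (a, c))"
      using assms[of a b c d] ab cd by (simp add: charging_def)
    also have "\<dots> = prob ({a<..b} \<times> {c<..d})"
      by (rule prob_rectangle[symmetric]) (use ab cd in auto)
    also have "\<dots> \<le> prob (U \<inter> unit_square)"
    proof (rule finite_measure_mono)
      show "{a<..b} \<times> {c<..d} \<subseteq> U \<inter> unit_square" using ab cd AB by auto
      show "U \<inter> unit_square \<in> events"
        using U(1) unit_square_borel by (auto simp: sets_\<mu>)
    qed
    also have "\<dots> = 0" using U(2) by (simp add: measure_def)
    finally show False by simp
  qed
  then show ?thesis
    unfolding measure_support_def space_\<mu> by blast
qed

end

theorem corollary3p10:
  shows "comeager_in (mtopology_of copula_metric)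
    {C \<in> copulas. mutually_completely_dependent C \<and>
                  measure_support (copula_measure C) = unit_square}"
proof -
  let ?X = "mtopology_of copula_metric"
  define Q where "Q = \<rat> \<inter> unit_interval"
  define R where "R = {(a :: real, b :: real, c :: real, d :: real). a \<in> \<rat> \<and> b \<in> \<rat> \<and> c \<in> \<rat> \<and> d \<in> \<rat> \<and>
    0 \<le> a \<and> a < b \<and> b \<le> 1 \<and> 0 \<le> c \<and> c < d \<and> d \<le> 1}"
  \<comment> \<open>Rational parameters leave countably many open dense sets: \<open>V1\<close>
    makes \<open>Y\<close> a function of \<open>X\<close>, \<open>V2\<close> makes \<open>X\<close>
    a function of \<open>Y\<close>, and \<open>V3\<close> gives full support.\<close>
  define V1 where "V1 = (\<lambda>(q, n). nearly_determined q (1 / real (Suc n))) ` (Q \<times> UNIV)"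
  define V2 where "V2 = (\<lambda>(q, n). {C \<in> copulas. swap_copula C \<in> nearly_determined q (1 / real (Suc n))})
    ` (Q \<times> UNIV)"
  define V3 where "V3 = (\<lambda>(a, b, c, d). charging a b c d) ` R"
  define N where "N = (\<lambda>V. copulas - V) ` (V1 \<union> V2 \<union> V3)"
  have "countable Q" unfolding Q_def by (rule countable_Int1[OF countable_rat])
  moreover have "R \<subseteq> \<rat> \<times> \<rat> \<times> \<rat> \<times> \<rat>" by (auto simp: R_def)
  then have "countable R"
    by (rule countable_subset) (intro countable_SIGMA countable_rat)
  ultimately have "countable N"
    unfolding N_def V1_def V2_def V3_def by (intro countable_image countable_Un countable_SIGMA) auto
  moreover have "nowhere_dense_in ?X M" if M: "M \<in> N" for M
  proof -
    obtain V where V: "M = copulas - V" "V \<in> V1 \<or> V \<in> V2 \<or> V \<in> V3"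
      using M by (auto simp: N_def)
    from V(2) show ?thesis
    proof (elim disjE)
      assume "V \<in> V1"
      then obtain q n where V_eq: "V = nearly_determined q (1 / real (Suc n))"
        and q: "q \<in> unit_interval"
        by (auto simp: V1_def Q_def)
      show ?thesis
        unfolding V(1) V_eq
        by (intro nowhere_dense_in_complement openin_nearly_determined nearly_determined_dense q) auto
    next
      assume "V \<in> V2"
      then obtain q n
        where V_eq: "V = {C \<in> copulas. swap_copula C \<in> nearly_determined q (1 / real (Suc n))}"
          and q: "q \<in> unit_interval"
        by (auto simp: V2_def Q_def)
      show ?thesis
        unfolding V(1) V_eq
        by (intro nowhere_dense_in_complement openin_swap_nearly_determined
            swap_nearly_determined_dense q) auto
    next
      assume "V \<in> V3"
      then obtain a b c d where V_eq: "V = charging a b c d"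
        and abcd: "0 \<le> a" "a < b" "b \<le> 1" "0 \<le> c" "c < d" "d \<le> 1"
        by (auto simp: V3_def R_def)
      show ?thesis
        unfolding V(1) V_eq
        by (intro nowhere_dense_in_complement openin_charging charging_dense abcd) (use abcd in auto)
    qed
  qed
  moreover have "C \<in> \<Union>N"
    if "C \<in> copulas" "\<not> (mutually_completely_dependent C \<and> measure_support (copula_measure C) = unit_square)"
    for C
  \<comment> \<open>A copula outside every set of \<open>N\<close> lies in all the open dense sets
    and therefore has both properties.\<close>
  proof (rule ccontr)
    assume "C \<notin> \<Union>N"
    then have *: "C \<in> V" if "V \<in> V1 \<union> V2 \<union> V3" for V
      using that \<open>C \<in> copulas\<close> by (auto simp: N_def)
    interpret copula C by unfold_locales fact
    have "C \<in> nearly_determined q (1 / real (Suc n))" if "q \<in> \<rat> \<inter> unit_interval" for q n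
      by (rule *) (use that in \<open>force simp: V1_def Q_def\<close>)
    moreover have "swap_copula C \<in> nearly_determined q (1 / real (Suc n))"
      if "q \<in> \<rat> \<inter> unit_interval" for q n
    proof -
      have "{C \<in> copulas. swap_copula C \<in> nearly_determined q (1 / real (Suc n))} \<in> V2"
        unfolding V2_def by (rule image_eqI[of _ _ "(q, n)"]) (use that in \<open>auto simp: Q_def\<close>)
      then show ?thesis using * by blast
    qed
    ultimately have "mutually_completely_dependent C"
      by (rule mutually_completely_dependent_of_nearly_determined)
    moreover have "measure_support \<mu> = unit_square"
    proof (rule full_support_of_charging)
      fix a b c d :: real
      assume "a \<in> \<rat>" "b \<in> \<rat>" "c \<in> \<rat>" "d \<in> \<rat>" "0 \<le> a" "a < b" "b \<le> 1" "0 \<le> c" "c < d" "d \<le> 1"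
      then have "charging a b c d \<in> V3"
        unfolding V3_def by (intro image_eqI[of _ _ "(a, b, c, d)"]) (auto simp: R_def)
      then show "C \<in> charging a b c d" using * by blast
    qed
    ultimately show False using that(2) by blast
  qed
  ultimately have "meager_in ?X (copulas - {C \<in> copulas. mutually_completely_dependent C \<and>
      measure_support (copula_measure C) = unit_square})"
    unfolding meager_in_def by (intro exI[of _ N]) auto
  then show ?thesis
    by (simp add: comeager_in_def)
qed

end
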